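(* Let $0<q<1$, $\alpha\in\mathbb{R}$ with $|\alpha|>1$, $\lambda>0$, $j\in\mathbb{N}$, and let $\{\mathbb{H}_n(x;q)\}_{n\ge0}$ be the $q$-Hermite I-Sobolev type polynomials. Then for every integer $n\ge2$ the following identity of rational functions in $x$ holds: $$\Xi_{1,n}(x)\,D_q\mathbb{H}_n(x;q)=\mathcal{E}_{4,n}(x)\,\mathbb{H}_n(x;q)+\mathcal{F}_{4,n}(x)\,\mathbb{H}_{n-1}(x;q),$$ where $$\mathcal{E}_{4,n}(x)=-\begin{vmatrix}\mathcal{E}_{2,n}(x)&\mathcal{E}_{3,n}(x)\\ \mathcal{F}_{2,n}(x)&\mathcal{F}_{3,n}(x)\end{vmatrix},\qquad \mathcal{F}_{4,n}(x)=\begin{vmatrix}\mathcal{E}_{1,n}(x)&\mathcal{E}_{3,n}(x)\\ \mathcal{F}_{1,n}(x)&\mathcal{F}_{3,n}(x)\end{vmatrix}.$$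
   Context: Here $\mathbb{N}=\{0,1,2,\dots\}$ and $0<q<1$. Notation: $[n]_q=\frac{1-q^n}{1-q}$, $[0]_q!=1$, $[n]_q!=[n]_q\cdots[1]_q$; $(a;q)_n=\prod_{i=0}^{n-1}(1-aq^i)$ (also for $n=\infty$), $(a_1,\dots,a_r;q)_n=\prod_i(a_i;q)_n$; $[n]_q^{(k)}=\frac{(q^{-n};q)_k}{(q-1)^k}q^{kn-\binom{k}{2}}$ (equal to $[n]_q[n-1]_q\cdots[n-k+1]_q$). The $q$-derivative is $D_qf(x)=\frac{f(qx)-f(x)}{(q-1)x}$ for $x\ne0$ (and $f'(0)$ at $x=0$), $D_q^0f=f$, $D_q^k=D_q D_q^{k-1}$; it acts on rational functions in $x$ by the same formula. The $q$-subtraction power is $(x\boxminus_q y)^m=\sum_{k=0}^m\frac{[m]_q!}{[k]_q![m-k]_q!}q^{\binom{k}{2}}(-y)^kx^{m-k}$ (equal to $\prod_{i=0}^{m-1}(x-q^iy)$). Monic $q$-Hermite I polynomials: $H_n(x;q)=q^{\binom n2}\sum_{k=0}^n\frac{(q^{-n};q)_k(x^{-1};q)_k}{(q;q)_k}(-qx)^k$ for $n\ge0$, and $H_m=0$ for $m<0$; equivalently $H_0=1$, $xH_n=H_{n+1}+\gamma_nH_{n-1}$ with $\gamma_n=q^{n-1}(1-q^n)$. Put $\|H_n\|^2=(1-q)(q;q)_n(q,-1,-q;q)_\infty q^{\binom n2}$ and $K_{n,q}^{(i,l)}(x,y)=\sum_{k=0}^n\frac{(D_q^iH_k)(x;q)\,(D_q^lH_k)(y;q)}{\|H_k\|^2}$.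 Sobolev inner product (on real polynomials): $\langle f,g\rangle_\lambda=\int_{-1}^1f(x)g(x)(qx,-qx;q)_\infty d_qx+\lambda (D_q^jf)(\alpha)(D_q^jg)(\alpha)$, where $\int_{-1}^1h(t)d_qt=(1-q)\sum_{m\ge0}q^m\big(h(q^m)+h(-q^m)\big)$. $\mathbb{H}_n(x;q)$ is the monic polynomial of degree $n$, $\{\mathbb{H}_n\}$ being orthogonal with respect to $\langle\cdot,\cdot\rangle_\lambda$. Put $\mathcal{A}_n^{(j)}(x,y)=\frac{[j]_q!}{\|H_{n-1}\|^2(x\boxminus_qy)^{j+1}}\sum_{k=0}^j\frac{(D_q^kH_{n-1})(y;q)}{[k]_q!}(x\boxminus_qy)^k$, $\mathcal{B}_n^{(j)}(x,y)=-\frac{[j]_q!}{\|H_{n-1}\|^2(x\boxminus_qy)^{j+1}}\sum_{k=0}^j\frac{(D_q^kH_{n})(y;q)}{[k]_q!}(x\boxminus_qy)^k$ $(n\ge1)$. With $D_q$ acting on $x$, for $n\ge2$: $\mathcal{C}_{1,n}(x,y)=D_q\mathcal{A}_n^{(j)}(x,y)-[n-1]_q\gamma_{n-1}^{-1}\mathcal{B}_n^{(j)}(qx,y)$, $\mathcal{D}_{1,n}(x,y)=[n]_q\mathcal{A}_n^{(j)}(qx,y)+[n-1]_q\gamma_{n-1}^{-1}x\,\mathcal{B}_n^{(j)}(qx,y)+D_q\mathcal{B}_n^{(j)}(x,y)$. With $c_n=\lambda\frac{[n]_q^{(j)}H_{n-j}(\alpha;q)}{1+\lambda K_{n-1,q}^{(j,j)}(\alpha,\alpha)}$: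 $\mathcal{E}_{1,n}(x)=1-c_n\mathcal{A}_n^{(j)}(x,\alpha)$, $\mathcal{F}_{1,n}(x)=-c_n\mathcal{B}_n^{(j)}(x,\alpha)$ $(n\ge1)$; and for $n\ge2$: $\mathcal{E}_{2,n}(x)=-\mathcal{F}_{1,n-1}(x)/\gamma_{n-1}$, $\mathcal{F}_{2,n}(x)=\mathcal{E}_{1,n-1}(x)-x\mathcal{E}_{2,n}(x)$; $\mathcal{E}_{3,n}(x)=-c_n\mathcal{C}_{1,n}(x,\alpha)$, $\mathcal{F}_{3,n}(x)=[n]_q-c_n\mathcal{D}_{1,n}(x,\alpha)$; $\Xi_{1,n}=\mathcal{E}_{1,n}\mathcal{F}_{2,n}-\mathcal{E}_{2,n}\mathcal{F}_{1,n}$. *)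

theory Defs
  imports "HOL-Analysis.Analysis" "HOL-Computational_Algebra.Polynomial"
begin

definition qnum :: "real \<Rightarrow> nat \<Rightarrow> real" where
  "qnum q n = (1 - q ^ n) / (1 - q)"

definition qfact :: "real \<Rightarrow> nat \<Rightarrow> real" where
  "qfact q n = (\<Prod>i=1..n. qnum q i)"

definition qpoch :: "real \<Rightarrow> real \<Rightarrow> nat \<Rightarrow> real" where
  "qpoch a q n = (\<Prod>i<n. 1 - a * q ^ i)"

definition qpoch_inf :: "real \<Rightarrow> real \<Rightarrow> real" where
  "qpoch_inf a q = (\<Prod>i. 1 - a * q ^ i)"

definition qfalling :: "real \<Rightarrow> nat \<Rightarrow> nat \<Rightarrow> real" where
  "qfalling q n k =
     qpoch (q powi (- int n)) q k / (q - 1) ^ k * q powi (int (k * n) - int (k choose 2))"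

definition qderiv :: "real \<Rightarrow> (real \<Rightarrow> real) \<Rightarrow> real \<Rightarrow> real" where
  "qderiv q f x = (if x = 0 then deriv f 0 else (f (q * x) - f x) / ((q - 1) * x))"

abbreviation qderiv_iter :: "real \<Rightarrow> nat \<Rightarrow> (real \<Rightarrow> real) \<Rightarrow> real \<Rightarrow> real" where
  "qderiv_iter q k f \<equiv> (qderiv q ^^ k) f"

definition qsub_pow :: "real \<Rightarrow> real \<Rightarrow> real \<Rightarrow> nat \<Rightarrow> real" where
  "qsub_pow q x y m =
     (\<Sum>k=0..m. qfact q m / (qfact q k * qfact q (m - k)) * q ^ (k choose 2) * (- y) ^ k * x ^ (m - k))"

definition jackson_integral :: "real \<Rightarrow> (real \<Rightarrow> real) \<Rightarrow> real" where
  "jackson_integral q h = (1 - q) * (\<Sum>m. q ^ m * (h (q ^ m) + h (- (q ^ m))))"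


text \<open>
  The monic q-Hermite I polynomials are given by a sum whose terms contain
  \<open>qpoch (inverse x) q k * (- q * x) ^ k\<close>.  This is a polynomial in \<open>x\<close>, but the literal
  expression has the wrong value at \<open>x = 0\<close> because of the convention \<open>inverse 0 = 0\<close>.
  The power of \<open>x\<close> is therefore absorbed into the product; lemma \<open>poly_qHermite\<close> recovers
  the original expression for \<open>x \<noteq> 0\<close>.
\<close>

definition qHermite :: "real \<Rightarrow> nat \<Rightarrow> real poly" where
  "qHermite q n =
     smult (q ^ (n choose 2))
       (\<Sum>k=0..n. smult (qpoch (q powi (- int n)) q k / qpoch q q k * (- q) ^ k)
                        (\<Prod>i<k. [:- (q ^ i), 1:]))"

lemma poly_qHermite:
  assumes "x \<noteq> 0"
  shows "poly (qHermite q n) x =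
     q ^ (n choose 2) *
       (\<Sum>k=0..n. qpoch (q powi (- int n)) q k * qpoch (inverse x) q k / qpoch q q k * (- q * x) ^ k)"
proof -
  have *: "(\<Prod>i<k. poly [:- (q ^ i), 1:] x) = qpoch (inverse x) q k * x ^ k" for k
  proof -
    have "qpoch (inverse x) q k * x ^ k = (\<Prod>i<k. (1 - inverse x * q ^ i) * x)"
      by (simp add: qpoch_def prod.distrib)
    also have "\<dots> = (\<Prod>i<k. poly [:- (q ^ i), 1:] x)"
      using assms by (intro prod.cong) (auto simp: field_simps)
    finally show ?thesis by simp
  qed
  show ?thesis
    unfolding qHermite_def poly_smult poly_sum poly_prod *
    by (simp only: power_mult_distrib mult_ac times_divide_eq_left times_divide_eq_right)
qed

definition qHermite_int :: "real \<Rightarrow> int \<Rightarrow> real poly" where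
  "qHermite_int q m = (if m < 0 then 0 else qHermite q (nat m))"

text \<open>The recurrence coefficient is used only for \<open>n \<ge> 1\<close>.\<close>

definition qHermite_gamma :: "real \<Rightarrow> nat \<Rightarrow> real" where
  "qHermite_gamma q n = q ^ (n - 1) * (1 - q ^ n)"

definition qHermite_norm2 :: "real \<Rightarrow> nat \<Rightarrow> real" where
  "qHermite_norm2 q n =
     (1 - q) * qpoch q q n * (qpoch_inf q q * qpoch_inf (- 1) q * qpoch_inf (- q) q) * q ^ (n choose 2)"

definition qkernel :: "real \<Rightarrow> nat \<Rightarrow> nat \<Rightarrow> nat \<Rightarrow> real \<Rightarrow> real \<Rightarrow> real" where
  "qkernel q n i l x y =
     (\<Sum>k=0..n. qderiv_iter q i (poly (qHermite q k)) x * qderiv_iter q l (poly (qHermite q k)) y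
                / qHermite_norm2 q k)"

definition sobolev_inner ::
    "real \<Rightarrow> real \<Rightarrow> real \<Rightarrow> nat \<Rightarrow> real poly \<Rightarrow> real poly \<Rightarrow> real" where
  "sobolev_inner q \<alpha> lam j f g =
     jackson_integral q (\<lambda>x. poly f x * poly g x * (qpoch_inf (q * x) q * qpoch_inf (- (q * x)) q))
     + lam * qderiv_iter q j (poly f) \<alpha> * qderiv_iter q j (poly g) \<alpha>"

definition qHermite_Sobolev ::
    "real \<Rightarrow> real \<Rightarrow> real \<Rightarrow> nat \<Rightarrow> (nat \<Rightarrow> real poly) \<Rightarrow> bool" where
  "qHermite_Sobolev q \<alpha> lam j P \<longleftrightarrow>
     (\<forall>n. degree (P n) = n \<and> lead_coeff (P n) = 1) \<and>
     (\<forall>m n. m \<noteq> n \<longrightarrow> sobolev_inner q \<alpha> lam j (P m) (P n) = 0)"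


text \<open>
  Rational functions of \<open>x\<close> are represented by the functions \<open>real \<Rightarrow> real\<close> they induce; their
  values are meaningful only away from the poles, which are the zeros in \<open>x\<close> of
  \<open>qsub_pow q x y (j + 1)\<close> and, for expressions containing \<open>qderiv\<close> or an argument \<open>q * x\<close>,
  also those of \<open>qsub_pow q (q * x) y (j + 1)\<close>.  The index \<open>n\<close> is at least 1 in
  \<open>SA\<close>, \<open>SB\<close>, \<open>Sc\<close>, \<open>SE1\<close>, \<open>SF1\<close> and at least 2 in all later definitions.
\<close>

definition SA :: "real \<Rightarrow> nat \<Rightarrow> nat \<Rightarrow> real \<Rightarrow> real \<Rightarrow> real" where
  "SA q j n x y =
     qfact q j / (qHermite_norm2 q (n - 1) * qsub_pow q x y (j + 1)) *
     (\<Sum>k=0..j. qderiv_iter q k (poly (qHermite q (n - 1))) y / qfact q k * qsub_pow q x y k)"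

definition SB :: "real \<Rightarrow> nat \<Rightarrow> nat \<Rightarrow> real \<Rightarrow> real \<Rightarrow> real" where
  "SB q j n x y =
     - (qfact q j / (qHermite_norm2 q (n - 1) * qsub_pow q x y (j + 1))) *
     (\<Sum>k=0..j. qderiv_iter q k (poly (qHermite q n)) y / qfact q k * qsub_pow q x y k)"

definition SC1 :: "real \<Rightarrow> nat \<Rightarrow> nat \<Rightarrow> real \<Rightarrow> real \<Rightarrow> real" where
  "SC1 q j n x y =
     qderiv q (\<lambda>t. SA q j n t y) x
     - qnum q (n - 1) / qHermite_gamma q (n - 1) * SB q j n (q * x) y"

definition SD1 :: "real \<Rightarrow> nat \<Rightarrow> nat \<Rightarrow> real \<Rightarrow> real \<Rightarrow> real" where
  "SD1 q j n x y =
     qnum q n * SA q j n (q * x) y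
     + qnum q (n - 1) / qHermite_gamma q (n - 1) * x * SB q j n (q * x) y
     + qderiv q (\<lambda>t. SB q j n t y) x"

definition Sc :: "real \<Rightarrow> real \<Rightarrow> real \<Rightarrow> nat \<Rightarrow> nat \<Rightarrow> real" where
  "Sc q \<alpha> lam j n =
     lam * (qfalling q n j * poly (qHermite_int q (int n - int j)) \<alpha>
            / (1 + lam * qkernel q (n - 1) j j \<alpha> \<alpha>))"

definition SE1 :: "real \<Rightarrow> real \<Rightarrow> real \<Rightarrow> nat \<Rightarrow> nat \<Rightarrow> real \<Rightarrow> real" where
  "SE1 q \<alpha> lam j n x = 1 - Sc q \<alpha> lam j n * SA q j n x \<alpha>"

definition SF1 :: "real \<Rightarrow> real \<Rightarrow> real \<Rightarrow> nat \<Rightarrow> nat \<Rightarrow> real \<Rightarrow> real" where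
  "SF1 q \<alpha> lam j n x = - Sc q \<alpha> lam j n * SB q j n x \<alpha>"

definition SE2 :: "real \<Rightarrow> real \<Rightarrow> real \<Rightarrow> nat \<Rightarrow> nat \<Rightarrow> real \<Rightarrow> real" where
  "SE2 q \<alpha> lam j n x = - SF1 q \<alpha> lam j (n - 1) x / qHermite_gamma q (n - 1)"

definition SF2 :: "real \<Rightarrow> real \<Rightarrow> real \<Rightarrow> nat \<Rightarrow> nat \<Rightarrow> real \<Rightarrow> real" where
  "SF2 q \<alpha> lam j n x = SE1 q \<alpha> lam j (n - 1) x - x * SE2 q \<alpha> lam j n x"

definition SE3 :: "real \<Rightarrow> real \<Rightarrow> real \<Rightarrow> nat \<Rightarrow> nat \<Rightarrow> real \<Rightarrow> real" where
  "SE3 q \<alpha> lam j n x = - Sc q \<alpha> lam j n * SC1 q j n x \<alpha>"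

definition SF3 :: "real \<Rightarrow> real \<Rightarrow> real \<Rightarrow> nat \<Rightarrow> nat \<Rightarrow> real \<Rightarrow> real" where
  "SF3 q \<alpha> lam j n x = qnum q n - Sc q \<alpha> lam j n * SD1 q j n x \<alpha>"

definition SXi1 :: "real \<Rightarrow> real \<Rightarrow> real \<Rightarrow> nat \<Rightarrow> nat \<Rightarrow> real \<Rightarrow> real" where
  "SXi1 q \<alpha> lam j n x =
     SE1 q \<alpha> lam j n x * SF2 q \<alpha> lam j n x - SE2 q \<alpha> lam j n x * SF1 q \<alpha> lam j n x"

definition SE4 :: "real \<Rightarrow> real \<Rightarrow> real \<Rightarrow> nat \<Rightarrow> nat \<Rightarrow> real \<Rightarrow> real" where
  "SE4 q \<alpha> lam j n x =
     - det (vector [vector [SE2 q \<alpha> lam j n x, SE3 q \<alpha> lam j n x],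
                    vector [SF2 q \<alpha> lam j n x, SF3 q \<alpha> lam j n x]] :: real ^ 2 ^ 2)"

definition SF4 :: "real \<Rightarrow> real \<Rightarrow> real \<Rightarrow> nat \<Rightarrow> nat \<Rightarrow> real \<Rightarrow> real" where
  "SF4 q \<alpha> lam j n x =
     det (vector [vector [SE1 q \<alpha> lam j n x, SE3 q \<alpha> lam j n x],
                  vector [SF1 q \<alpha> lam j n x, SF3 q \<alpha> lam j n x]] :: real ^ 2 ^ 2)"

end

theory Submission imports Defs
begin

text \<open>
  The asserted relation is Cramer's rule.  Write \<open>u = H\<^sub>n(x)\<close> and \<open>v = H\<^sub>n\<^sub>-\<^sub>1(x)\<close>.  Each of the three
  quantities \<open>P\<^sub>n(x)\<close>, \<open>P\<^sub>n\<^sub>-\<^sub>1(x)\<close> and \<open>(D\<^sub>q P\<^sub>n)(x)\<close> is a combination of \<open>u\<close> and \<open>v\<close>, with the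
  coefficient pairs \<open>(E\<^sub>1, F\<^sub>1)\<close>, \<open>(E\<^sub>2, F\<^sub>2)\<close> and \<open>(E\<^sub>3, F\<^sub>3)\<close>; three vectors in a plane satisfy one
  linear relation, and its coefficients are the \<open>2 \<times> 2\<close> minors \<open>\<Xi>\<^sub>1\<close>, \<open>E\<^sub>4\<close> and \<open>F\<^sub>4\<close>.  All the
  work lies in the three expansions.

  They rest on the connection formula \<open>P\<^sub>n(x) = H\<^sub>n(x) - c\<^sub>n K(x, \<alpha>)\<close>, where \<open>K\<close> is the kernel of
  index \<open>n - 1\<close> differentiated \<open>j\<close> times in its second variable (\<open>connection_formula\<close>).  Expand
  \<open>P\<^sub>n - H\<^sub>n\<close> in \<open>H\<^sub>0, \<dots>, H\<^sub>n\<^sub>-\<^sub>1\<close>: Sobolev orthogonality to \<open>H\<^sub>k\<close> gives each coefficient as a multiple of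
  the single unknown \<open>(D\<^sub>q\<^sup>j P\<^sub>n)(\<alpha>)\<close>, and applying \<open>D\<^sub>q\<^sup>j\<close> at \<open>\<alpha>\<close> determines that unknown.  This
  needs the orthogonality of the \<open>H\<^sub>k\<close> together with the exact value of their norms, because \<open>\<lambda>\<close>
  enters \<open>c\<^sub>n\<close> unscaled.

  Orthogonality follows from the recurrence \<open>x H\<^sub>n = H\<^sub>n\<^sub>+\<^sub>1 + \<gamma>\<^sub>n H\<^sub>n\<^sub>-\<^sub>1\<close> (\<open>qHermite_Suc\<close>) as soon as
  the integral of \<open>H\<^sub>n\<close> vanishes for \<open>n \<ge> 1\<close>.  The latter comes from the \<open>q\<close>-Pearson equation of
  the weight, which makes a Jackson sum telescope (\<open>hermite_integral_by_parts\<close>).  The norms then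
  reduce to the total mass, which Euler's series for \<open>1 / (z; q\<^sup>2)\<^sub>\<infinity>\<close> at \<open>z = q\<close> evaluates
  (\<open>euler_sum\<close>).

  Finally, the recurrence gives the Christoffel-Darboux identity for \<open>(x - y) K(x, y)\<close>
  (\<open>christoffel_darboux\<close>).  Applying \<open>D\<^sub>q\<close> repeatedly in \<open>y\<close> and solving the resulting recursion for
  the derivatives of \<open>K\<close> produces the \<open>q\<close>-Taylor sums that define \<open>SA\<close> and \<open>SB\<close>
  (\<open>qdiff_iter_divided\<close>, \<open>qkernel_eq_SA_SB\<close>).
\<close>

section \<open>The \<open>q\<close>-derivative on polynomials\<close>

text \<open>
  The coefficientwise description of \<open>D\<^sub>q\<close>.  It avoids the case distinction between \<open>x = 0\<close> and
  \<open>x \<noteq> 0\<close> in \<open>qderiv\<close> and makes iterates of \<open>D\<^sub>q\<close> polynomials again.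
\<close>

definition qdiff_poly :: "real \<Rightarrow> real poly \<Rightarrow> real poly" where
  "qdiff_poly q p = (\<Sum>i\<le>degree p. monom (qnum q (Suc i) * coeff p (Suc i)) i)"

lemma qnum_0 [simp]: "qnum q 0 = 0"
  by (simp add: qnum_def)

lemma qnum_Suc: "q \<noteq> 1 \<Longrightarrow> qnum q (Suc n) = 1 + q * qnum q n"
  by (simp add: qnum_def field_simps)

lemma qnum_add: "q \<noteq> 1 \<Longrightarrow> qnum q (m + n) = qnum q m + q ^ m * qnum q n"
  by (simp add: qnum_def divide_simps) (simp add: algebra_simps power_add)

lemma qnum_pos: "0 < q \<Longrightarrow> q < 1 \<Longrightarrow> 0 < n \<Longrightarrow> qnum q n > 0"
  by (simp add: qnum_def power_less_one_iff)

lemma coeff_qdiff_poly: "coeff (qdiff_poly q p) i = qnum q (Suc i) * coeff p (Suc i)"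
  by (simp add: qdiff_poly_def coeff_sum coeff_eq_0)

lemma qdiff_poly_0 [simp]: "qdiff_poly q 0 = 0"
  by (rule poly_eqI) (simp add: coeff_qdiff_poly)

lemma qdiff_poly_add: "qdiff_poly q (p + r) = qdiff_poly q p + qdiff_poly q r"
  by (rule poly_eqI) (simp add: coeff_qdiff_poly algebra_simps)

lemma qdiff_poly_diff: "qdiff_poly q (p - r) = qdiff_poly q p - qdiff_poly q r"
  by (rule poly_eqI) (simp add: coeff_qdiff_poly algebra_simps)

lemma qdiff_poly_smult: "qdiff_poly q (smult c p) = smult c (qdiff_poly q p)"
  by (rule poly_eqI) (simp add: coeff_qdiff_poly)

text \<open>
  The product rule for \<open>D\<^sub>q\<close> with the factor \<open>x\<close>.  Since polynomials are built by \<open>pCons\<close>, it is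
  the only product rule that the polynomial part of the argument uses.
\<close>

lemma qdiff_poly_pCons:
  "q \<noteq> 1 \<Longrightarrow> qdiff_poly q (pCons a p) = smult q (pCons 0 (qdiff_poly q p)) + p"
  by (rule poly_eqI)
     (auto simp: coeff_qdiff_poly coeff_pCons qnum_Suc algebra_simps split: nat.split)

lemma poly_qdiff_poly_mult:
  assumes "q \<noteq> 1"
  shows "poly (qdiff_poly q p) x * ((q - 1) * x) = poly p (q * x) - poly p x"
  using assms
proof (induction p)
  case (pCons a p)
  have "poly (qdiff_poly q (pCons a p)) x * ((q - 1) * x)
      = q * x * (poly (qdiff_poly q p) x * ((q - 1) * x)) + poly p x * ((q - 1) * x)"
    using pCons.prems by (simp add: qdiff_poly_pCons algebra_simps)
  also have "\<dots> = poly (pCons a p) (q * x) - poly (pCons a p) x"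
    unfolding pCons.IH[OF pCons.prems] by (simp add: algebra_simps)
  finally show ?case .
qed simp

text \<open>
  At \<open>x = 0\<close> the two sides agree because \<open>[1]\<^sub>q = 1\<close>, so the ordinary derivative and \<open>D\<^sub>q\<close> both
  read off the linear coefficient.
\<close>

lemma qderiv_poly:
  assumes "q \<noteq> 1"
  shows "qderiv q (poly p) = poly (qdiff_poly q p)"
proof
  fix x
  show "qderiv q (poly p) x = poly (qdiff_poly q p) x"
  proof (cases "x = 0")
    case True
    have "deriv (poly p) 0 = poly (pderiv p) 0"
      by (rule DERIV_imp_deriv) (rule poly_DERIV)
    also have "\<dots> = coeff p 1"
      by (simp add: poly_0_coeff_0 coeff_pderiv)
    also have "\<dots> = poly (qdiff_poly q p) 0"
      using assms by (simp add: poly_0_coeff_0 coeff_qdiff_poly qnum_def)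
    finally show ?thesis
      using True by (simp add: qderiv_def)
  next
    case False
    then show ?thesis
      using assms poly_qdiff_poly_mult[OF assms, of p x] by (simp add: qderiv_def divide_simps)
  qed
qed

lemma qderiv_iter_poly: "q \<noteq> 1 \<Longrightarrow> qderiv_iter q k (poly p) = poly ((qdiff_poly q ^^ k) p)"
  by (induction k) (simp_all add: qderiv_poly)

lemma qdiff_iter_add:
  "(qdiff_poly q ^^ k) (p + r) = (qdiff_poly q ^^ k) p + (qdiff_poly q ^^ k) r"
  by (induction k) (simp_all add: qdiff_poly_add)

lemma qdiff_iter_diff:
  "(qdiff_poly q ^^ k) (p - r) = (qdiff_poly q ^^ k) p - (qdiff_poly q ^^ k) r"
  by (induction k) (simp_all add: qdiff_poly_diff)

lemma qdiff_iter_smult: "(qdiff_poly q ^^ k) (smult c p) = smult c ((qdiff_poly q ^^ k) p)"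
  by (induction k) (simp_all add: qdiff_poly_smult)

lemma qdiff_iter_sum:
  "(qdiff_poly q ^^ k) (\<Sum>i\<in>S. f i) = (\<Sum>i\<in>S. (qdiff_poly q ^^ k) (f i))"
proof (induction S rule: infinite_finite_induct)
  case (insert x F)
  then show ?case by (simp add: qdiff_iter_add)
qed (induction k; simp)+

section \<open>Gaussian binomial coefficients\<close>

text \<open>
  The value \<open>0\<close> for \<open>k > n\<close> lets Pascal's rule hold at the boundary.
\<close>

definition qbinom :: "real \<Rightarrow> nat \<Rightarrow> nat \<Rightarrow> real" where
  "qbinom q n k = (if k \<le> n then qfact q n / (qfact q k * qfact q (n - k)) else 0)"

lemma qfact_0 [simp]: "qfact q 0 = 1"
  by (simp add: qfact_def)

lemma qfact_Suc: "qfact q (Suc n) = qnum q (Suc n) * qfact q n"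
  by (simp add: qfact_def)

lemma qfact_pos: "0 < q \<Longrightarrow> q < 1 \<Longrightarrow> qfact q n > 0"
  by (induction n) (simp_all add: qfact_Suc qnum_pos)

lemma qbinom_0 [simp]: "0 < q \<Longrightarrow> q < 1 \<Longrightarrow> qbinom q n 0 = 1"
  using qfact_pos[of q n] by (simp add: qbinom_def)

lemma qbinom_self [simp]: "0 < q \<Longrightarrow> q < 1 \<Longrightarrow> qbinom q n n = 1"
  using qfact_pos[of q n] by (simp add: qbinom_def)

lemma qbinom_eq_0 [simp]: "n < k \<Longrightarrow> qbinom q n k = 0"
  by (simp add: qbinom_def)

text \<open>
  The two absorption rules combine to the two forms of Pascal's rule by splitting \<open>[n + 1]\<^sub>q\<close> as
  \<open>[k + 1]\<^sub>q + q\<^sup>k\<^sup>+\<^sup>1 [n - k]\<^sub>q\<close> or as \<open>[n - k]\<^sub>q + q\<^sup>n\<^sup>-\<^sup>k [k + 1]\<^sub>q\<close>.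
\<close>

lemma qbinom_absorb_comp:
  assumes "0 < q" "q < 1" "k \<le> n"
  shows "qnum q (Suc n - k) * qbinom q (Suc n) k = qnum q (Suc n) * qbinom q n k"
  using assms qfact_pos[of q k] qfact_pos[of q "n - k"] qnum_pos[of q "Suc (n - k)"]
  by (simp add: qbinom_def Suc_diff_le qfact_Suc divide_simps)

lemma qbinom_absorb:
  assumes "0 < q" "q < 1"
  shows "qnum q (Suc k) * qbinom q (Suc n) (Suc k) = qnum q (Suc n) * qbinom q n k"
  using assms qfact_pos[of q k] qfact_pos[of q "n - k"] qnum_pos[of q "Suc k"]
  by (simp add: qbinom_def qfact_Suc divide_simps)

lemma qbinom_Suc_Suc:
  assumes "0 < q" "q < 1"
  shows "qbinom q (Suc n) (Suc k) = qbinom q n k + q ^ Suc k * qbinom q n (Suc k)"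
proof (cases "Suc k \<le> n")
  case True
  have "qnum q (Suc n) * qbinom q (Suc n) (Suc k)
      = (qnum q (Suc k) + q ^ Suc k * qnum q (Suc n - Suc k)) * qbinom q (Suc n) (Suc k)"
    using qnum_add[of q "Suc k" "Suc n - Suc k"] True assms by simp
  also have "\<dots> = qnum q (Suc n) * (qbinom q n k + q ^ Suc k * qbinom q n (Suc k))"
    using qbinom_absorb[OF assms, of k n] qbinom_absorb_comp[OF assms True]
    by (simp only: distrib_left distrib_right mult_ac)
  finally show ?thesis
    using qnum_pos[of q "Suc n"] assms by simp
next
  case False
  then consider "k = n" | "k > n" by linarith
  then show ?thesis
    using assms by cases simp_all
qed

lemma qbinom_Suc_Suc':
  assumes "0 < q" "q < 1" "k \<le> n"
  shows "qbinom q (Suc n) (Suc k) = q ^ (n - k) * qbinom q n k + qbinom q n (Suc k)"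
proof (cases "Suc k \<le> n")
  case True
  have "qnum q (Suc n) * qbinom q (Suc n) (Suc k)
      = (qnum q (n - k) + q ^ (n - k) * qnum q (Suc k)) * qbinom q (Suc n) (Suc k)"
    using qnum_add[of q "n - k" "Suc k"] True assms by simp
  also have "\<dots> = qnum q (Suc n) * (q ^ (n - k) * qbinom q n k + qbinom q n (Suc k))"
    using qbinom_absorb[OF assms(1,2), of k n] qbinom_absorb_comp[OF assms(1,2) True]
    by (simp add: distrib_left distrib_right mult.assoc mult.left_commute[of _ "q ^ (n - k)"])
  finally show ?thesis
    using qnum_pos[of q "Suc n"] assms by simp
next
  case False
  with assms show ?thesis by (auto simp: not_le le_less_Suc_eq)
qed

lemma zero_choose_two [simp]: "(0 choose 2) = 0"
  by (simp add: numeral_2_eq_2)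

lemma choose_two_Suc: "(Suc n choose 2) = (n choose 2) + n"
  by (simp add: numeral_2_eq_2)

text \<open>
  Gauss's \<open>q\<close>-binomial theorem.  Pascal's rule splits the sum for \<open>m + 1\<close> into \<open>x\<close> times and
  \<open>- q\<^sup>m y\<close> times the sum for \<open>m\<close>.
\<close>

lemma qsub_pow_eq_prod:
  assumes q: "0 < q" "q < 1"
  shows "qsub_pow q x y m = (\<Prod>i<m. x - q ^ i * y)"
proof (induction m)
  case 0
  show ?case by (simp add: qsub_pow_def)
next
  case (Suc m)
  define T where "T m k = qbinom q m k * q ^ (k choose 2) * (- y) ^ k * x ^ (m - k)" for m k
  have T: "qsub_pow q x y m = (\<Sum>k\<le>m. T m k)" for m
    unfolding qsub_pow_def T_def atLeast0AtMost by (intro sum.cong) (auto simp: qbinom_def)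
  have step: "T (Suc m) (Suc k) = x * T m (Suc k) - q ^ m * y * T m k" if "k \<le> m" for k
  proof -
    have e: "q ^ (m - k) * q ^ k = q ^ m"
      using that by (simp flip: power_add)
    have "x * T m (Suc k) = qbinom q m (Suc k) * q ^ (Suc k choose 2) * (- y) ^ Suc k * x ^ (m - k)"
    proof (cases "Suc k \<le> m")
      case True
      then have "x ^ (m - k) = x * x ^ (m - Suc k)"
        by (metis Suc_diff_Suc Suc_le_eq power_Suc)
      then show ?thesis by (simp add: T_def)
    qed (simp add: T_def)
    moreover have "- (q ^ m) * y * T m k
        = q ^ (m - k) * qbinom q m k * q ^ (Suc k choose 2) * (- y) ^ Suc k * x ^ (m - k)"
      by (simp add: T_def choose_two_Suc power_add flip: e)
    moreover have "T (Suc m) (Suc k) = (q ^ (m - k) * qbinom q m k + qbinom q m (Suc k))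
        * q ^ (Suc k choose 2) * (- y) ^ Suc k * x ^ (m - k)"
      using that qbinom_Suc_Suc'[OF q that] by (simp add: T_def)
    ultimately show ?thesis
      by (simp only: distrib_right)
  qed
  have "qsub_pow q x y (Suc m) = T (Suc m) 0 + (\<Sum>k\<le>m. T (Suc m) (Suc k))"
    by (simp only: T sum.atMost_Suc_shift)
  also have "(\<Sum>k\<le>m. T (Suc m) (Suc k)) = x * (\<Sum>k\<le>m. T m (Suc k)) - q ^ m * y * (\<Sum>k\<le>m. T m k)"
    by (simp add: step sum_subtractf sum_distrib_left)
  also have "T (Suc m) 0 = x * T m 0"
    using q by (simp add: T_def)
  also have "x * T m 0 + (x * (\<Sum>k\<le>m. T m (Suc k)) - q ^ m * y * (\<Sum>k\<le>m. T m k))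
      = x * (\<Sum>k\<le>Suc m. T m k) - q ^ m * y * (\<Sum>k\<le>m. T m k)"
    by (subst sum.atMost_Suc_shift) (simp add: algebra_simps)
  also have "(\<Sum>k\<le>Suc m. T m k) = (\<Sum>k\<le>m. T m k)"
    by (simp add: T_def)
  finally show ?case
    by (simp add: T[symmetric] Suc.IH algebra_simps)
qed

lemma qsub_pow_0 [simp]: "qsub_pow q x y 0 = 1"
  by (simp add: qsub_pow_def)

lemma qsub_pow_Suc:
  "0 < q \<Longrightarrow> q < 1 \<Longrightarrow> qsub_pow q x y (Suc m) = qsub_pow q x y m * (x - q ^ m * y)"
  by (simp add: qsub_pow_eq_prod)

section \<open>Recurrence and lowering relation\<close>

text \<open>
  The \<open>q\<close>-subtraction powers of \<open>x\<close> and \<open>1\<close>, which play the role of \<open>(x - 1)\<^sup>k\<close>.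
\<close>

definition shifted_powers :: "real \<Rightarrow> nat \<Rightarrow> real poly" where
  "shifted_powers q k = (\<Prod>i<k. [:- (q ^ i), 1:])"

lemma smult_sum_right: "smult (c::real) (\<Sum>i\<in>S. f i) = (\<Sum>i\<in>S. smult c (f i))"
  by (induction S rule: infinite_finite_induct) (simp_all add: smult_add_right)

lemma shifted_powers_Suc:
  "shifted_powers q (Suc k) = pCons 0 (shifted_powers q k) - smult (q ^ k) (shifted_powers q k)"
  by (simp add: shifted_powers_def mult.commute)

lemma qpoch_0 [simp]: "qpoch a q 0 = 1"
  by (simp add: qpoch_def)

lemma qpoch_Suc: "qpoch a q (Suc n) = qpoch a q n * (1 - a * q ^ n)"
  by (simp add: qpoch_def)

lemma qpoch_q_eq_qfact: "q \<noteq> 1 \<Longrightarrow> qpoch q q n = (1 - q) ^ n * qfact q n"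
  by (induction n) (simp_all add: qpoch_Suc qfact_Suc qnum_def)

text \<open>
  Each factor \<open>1 - q\<^sup>i\<^sup>-\<^sup>n\<close>, multiplied by \<open>q\<^sup>n\<close>, becomes \<open>(q - 1) q\<^sup>i [n - i]\<^sub>q\<close>.  This clears the negative
  exponents in both \<open>qHermite\<close> and \<open>qfalling\<close>.
\<close>

lemma qpoch_neg_power:
  assumes q: "0 < q" "q < 1" and "k \<le> n"
  shows "qpoch (q powi (- int n)) q k * q ^ (k * n)
    = (q - 1) ^ k * q ^ (k choose 2) * (qfact q n / qfact q (n - k))"
  using \<open>k \<le> n\<close>
proof (induction k)
  case 0
  show ?case using qfact_pos[OF q, of n] by simp
next
  case (Suc k)
  have f: "qfact q (n - k) = qnum q (n - k) * qfact q (n - Suc k)"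
    using Suc.prems by (metis Suc_diff_Suc Suc_le_eq qfact_Suc)
  have p: "qnum q (n - k) > 0" "qfact q (n - Suc k) > 0"
    using q Suc.prems by (simp_all add: qnum_pos qfact_pos)
  have e: "q powi (- int n) * q ^ n = 1"
    using q by (simp add: power_int_minus)
  have s: "q ^ n = q ^ k * q ^ (n - k)"
    using Suc.prems by (simp flip: power_add)
  have t: "(1 - q powi (- int n) * q ^ k) * q ^ n = (q - 1) * q ^ k * qnum q (n - k)"
  proof -
    have "(1 - q powi (- int n) * q ^ k) * q ^ n = q ^ n - q ^ k"
      using e by (simp add: algebra_simps)
    also have "\<dots> = (q - 1) * q ^ k * qnum q (n - k)"
      using q by (subst s) (simp add: qnum_def divide_simps, simp add: algebra_simps)
    finally show ?thesis .
  qed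
  have "qpoch (q powi (- int n)) q (Suc k) * q ^ (Suc k * n)
      = (qpoch (q powi (- int n)) q k * q ^ (k * n)) * ((1 - q powi (- int n) * q ^ k) * q ^ n)"
    by (simp add: qpoch_Suc power_add)
  also have "\<dots> = (q - 1) ^ Suc k * q ^ (Suc k choose 2) * (qfact q n / qfact q (n - Suc k))"
    using Suc p by (simp add: t f choose_two_Suc power_add)
  finally show ?case .
qed

text \<open>
  The exponent of \<open>q\<close> is \<open>(n choose 2) + (k choose 2) + k - n k\<close>, a binomial coefficient again.
\<close>

lemma qHermite_eq:
  assumes q: "0 < q" "q < 1"
  shows "qHermite q n = (\<Sum>k\<le>n. smult (qbinom q n k * q ^ ((n - k) choose 2)) (shifted_powers q k))"
proof -
  have coef: "q ^ (n choose 2) * (qpoch (q powi (- int n)) q k / qpoch q q k * (- q) ^ k)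
      = qbinom q n k * q ^ ((n - k) choose 2)" if "k \<le> n" for k
  proof -
    have c: "(n choose 2) + (k choose 2) + k = ((n - k) choose 2) + k * n"
    proof -
      obtain r where r: "n = k + r" using le_Suc_ex[OF \<open>k \<le> n\<close>] by blast
      have "((k + r) choose 2) + (k choose 2) + k = (r choose 2) + k * (k + r)"
      proof (induction k)
        case (Suc k)
        then show ?case by (simp add: choose_two_Suc)
      qed simp
      then show ?thesis by (simp add: r)
    qed
    have pos: "q ^ (k * n) > 0" "qfact q k > 0" "qfact q (n - k) > 0" "(1 - q) ^ k > 0"
      using q by (simp_all add: qfact_pos)
    have sg: "(- q) ^ k * (q - 1) ^ k = q ^ k * (1 - q) ^ k"
      by (simp flip: power_mult_distrib) (simp add: algebra_simps)
    have "q ^ (n choose 2) * (qpoch (q powi (- int n)) q k / qpoch q q k * (- q) ^ k) * q ^ (k * n)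
       = q ^ (n choose 2) * (qpoch (q powi (- int n)) q k * q ^ (k * n)) * (- q) ^ k / qpoch q q k"
      by (simp add: mult_ac)
    also have "\<dots> = q ^ (n choose 2) * q ^ (k choose 2) * ((- q) ^ k * (q - 1) ^ k)
        * (qfact q n / qfact q (n - k)) / qpoch q q k"
      unfolding qpoch_neg_power[OF q that] by (simp add: mult_ac)
    also have "\<dots> = q ^ ((n choose 2) + (k choose 2) + k) * qbinom q n k"
      using q pos that by (simp add: sg qpoch_q_eq_qfact qbinom_def power_add mult_ac)
    also have "\<dots> = qbinom q n k * q ^ ((n - k) choose 2) * q ^ (k * n)"
      by (simp add: c power_add)
    finally show ?thesis
      using pos(1) by (metis less_irrefl mult_right_cancel)
  qed
  show ?thesis
    unfolding qHermite_def smult_sum_right smult_smult atLeast0AtMost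
    by (intro sum.cong refl) (simp only: coef atMost_iff shifted_powers_def)
qed

lemma qHermite_0 [simp]: "qHermite q 0 = 1"
  by (simp add: qHermite_def numeral_2_eq_2)

lemma sum_pCons_0: "(\<Sum>i\<in>S. pCons 0 (f i)) = pCons (0::real) (\<Sum>i\<in>S. f i)"
  by (induction S rule: infinite_finite_induct) simp_all

text \<open>
  Since \<open>x \<phi>\<^sub>k = \<phi>\<^sub>k\<^sub>+\<^sub>1 + q\<^sup>k \<phi>\<^sub>k\<close> for the shifted powers \<open>\<phi>\<^sub>k\<close>, Pascal's rule turns the expansion of
  \<open>H\<^sub>n\<^sub>+\<^sub>1\<close> into \<open>x H\<^sub>n\<close> plus the same expansion of \<open>H\<^sub>n\<close> with weights \<open>q\<^sup>n - q\<^sup>k\<close>.  These weights vanish at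
  \<open>k = n\<close>, and absorption identifies the remaining sum with \<open>- \<gamma>\<^sub>n H\<^sub>n\<^sub>-\<^sub>1\<close>.  For \<open>n = 0\<close> the
  coefficient \<open>\<gamma>\<^sub>0\<close> is zero.
\<close>

lemma qHermite_Suc:
  assumes q: "0 < q" "q < 1"
  shows "qHermite q (Suc n)
    = pCons 0 (qHermite q n) - smult (qHermite_gamma q n) (qHermite q (n - 1))"
proof -
  define b where "b n k = qbinom q n k * q ^ ((n - k) choose 2)" for n k
  let ?\<phi> = "shifted_powers q"
  have H: "qHermite q n = (\<Sum>k\<le>n. smult (b n k) (?\<phi> k))" for n
    by (simp add: qHermite_eq[OF q] b_def)
  have b1: "b (Suc n) (Suc k) = b n k + q ^ n * b n (Suc k)" if "k \<le> n" for k
  proof (cases "k = n")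
    case False
    then obtain r where r: "n = Suc (k + r)"
      using less_imp_Suc_add[of k n] \<open>k \<le> n\<close> by auto
    show ?thesis
      using qbinom_Suc_Suc[OF q, of n k]
      by (simp add: b_def r Suc_diff_le choose_two_Suc power_add algebra_simps)
  qed (use q in \<open>simp add: b_def\<close>)
  have b0: "b (Suc n) 0 = q ^ n * b n 0"
    using q by (simp add: b_def choose_two_Suc power_add)
  have b2: "(q ^ n - q ^ k) * b n k = - qHermite_gamma q n * b (n - 1) k" if "k < n" for k
  proof -
    obtain r where r: "n = Suc (k + r)"
      using less_imp_Suc_add[OF \<open>k < n\<close>] by blast
    have "(1 - q ^ Suc r) * qbinom q (Suc (k + r)) k = (1 - q ^ n) * qbinom q (k + r) k"
      using qbinom_absorb_comp[OF q, of k "k + r"] q by (simp add: qnum_def r)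
    then have *: "(1 - q ^ Suc r) * qbinom q n k = (1 - q ^ n) * qbinom q (k + r) k"
      by (simp add: r)
    have "(q ^ n - q ^ k) * b n k
        = - (q ^ k * q ^ (Suc r choose 2)) * ((1 - q ^ Suc r) * qbinom q n k)"
      by (simp add: b_def r power_add algebra_simps)
    also have "\<dots> = - qHermite_gamma q n * b (n - 1) k"
      unfolding * by (simp add: b_def qHermite_gamma_def r choose_two_Suc power_add algebra_simps)
    finally show ?thesis .
  qed
  have "qHermite q (Suc n) = smult (b (Suc n) 0) (?\<phi> 0)
      + (\<Sum>k\<le>n. smult (b (Suc n) (Suc k)) (?\<phi> (Suc k)))"
    by (simp only: H sum.atMost_Suc_shift)
  also have "\<dots> = smult (q ^ n * b n 0) (?\<phi> 0)
      + (\<Sum>k\<le>n. smult (q ^ n * b n (Suc k)) (?\<phi> (Suc k))) + (\<Sum>k\<le>n. smult (b n k) (?\<phi> (Suc k)))"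
    by (simp add: b0 b1 smult_add_left sum.distrib add_ac)
  also have "smult (q ^ n * b n 0) (?\<phi> 0) + (\<Sum>k\<le>n. smult (q ^ n * b n (Suc k)) (?\<phi> (Suc k)))
      = (\<Sum>k\<le>Suc n. smult (q ^ n * b n k) (?\<phi> k))"
    by (simp only: sum.atMost_Suc_shift)
  also have "\<dots> = (\<Sum>k\<le>n. smult (q ^ n * b n k) (?\<phi> k))"
    by (simp add: b_def)
  also have "(\<Sum>k\<le>n. smult (q ^ n * b n k) (?\<phi> k)) + (\<Sum>k\<le>n. smult (b n k) (?\<phi> (Suc k)))
      = pCons 0 (\<Sum>k\<le>n. smult (b n k) (?\<phi> k)) + (\<Sum>k\<le>n. smult ((q ^ n - q ^ k) * b n k) (?\<phi> k))"
    by (simp add: shifted_powers_Suc smult_diff_right smult_diff_left left_diff_distrib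
        sum_subtractf sum_pCons_0[symmetric] mult.commute[of "b n _"])
  also have "(\<Sum>k\<le>n. smult ((q ^ n - q ^ k) * b n k) (?\<phi> k))
      = (\<Sum>k<n. smult ((q ^ n - q ^ k) * b n k) (?\<phi> k))"
    by (simp add: lessThan_Suc_atMost[symmetric])
  also have "\<dots> = (\<Sum>k<n. smult (- qHermite_gamma q n) (smult (b (n - 1) k) (?\<phi> k)))"
    by (intro sum.cong refl) (simp only: b2 lessThan_iff smult_smult)
  also have "\<dots> = - smult (qHermite_gamma q n) (qHermite q (n - 1))"
  proof (cases n)
    case 0
    then show ?thesis by (simp add: qHermite_gamma_def)
  next
    case (Suc m)
    then show ?thesis
      by (simp add: H lessThan_Suc_atMost smult_sum_right sum_negf)
  qed
  finally show ?thesis by (simp add: H)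
qed

lemma degree_lead_coeff_qHermite:
  assumes q: "0 < q" "q < 1"
  shows "degree (qHermite q n) = n \<and> lead_coeff (qHermite q n) = 1"
proof (induction n rule: less_induct)
  case (less n)
  show ?case
  proof (cases n)
    case (Suc m)
    have IH: "degree (qHermite q m) = m" "lead_coeff (qHermite q m) = 1"
      using less[of m] Suc by auto
    then have nz: "qHermite q m \<noteq> 0" by auto
    have d: "degree (pCons 0 (qHermite q m)) = n"
      using IH nz by (simp add: Suc)
    have "degree (smult (qHermite_gamma q m) (qHermite q (m - 1))) \<le> degree (qHermite q (m - 1))"
      by (rule degree_smult_le)
    then have l: "degree (smult (qHermite_gamma q m) (qHermite q (m - 1))) < n"
      using less[of "m - 1"] Suc by simp
    have "degree (qHermite q n) = n"
      unfolding Suc qHermite_Suc[OF q] using d l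
      by (metis Suc degree_add_eq_left degree_minus diff_conv_add_uminus)
    moreover have "coeff (qHermite q n) n = 1"
      unfolding Suc qHermite_Suc[OF q] using IH l Suc
      by (simp only: coeff_diff coeff_pCons coeff_eq_0[OF l[unfolded Suc]]) simp
    ultimately show ?thesis by simp
  qed simp
qed

lemma degree_qHermite: "0 < q \<Longrightarrow> q < 1 \<Longrightarrow> degree (qHermite q n) = n"
  using degree_lead_coeff_qHermite by blast

lemma coeff_qHermite_self: "0 < q \<Longrightarrow> q < 1 \<Longrightarrow> coeff (qHermite q n) n = 1"
  using degree_lead_coeff_qHermite by metis

text \<open>
  Apply \<open>D\<^sub>q\<close> to the recurrence.  The induction closes because
  \<open>q [n + 1]\<^sub>q \<gamma>\<^sub>n = \<gamma>\<^sub>n\<^sub>+\<^sub>1 [n]\<^sub>q\<close>.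
\<close>

lemma qdiff_qHermite:
  assumes q: "0 < q" "q < 1"
  shows "qdiff_poly q (qHermite q n) = smult (qnum q n) (qHermite q (n - 1))"
proof (induction n rule: less_induct)
  case (less n)
  have q1: "q \<noteq> 1" using q by simp
  consider "n = 0" | "n = 1" | m where "n = Suc (Suc m)"
    by (metis One_nat_def not0_implies_Suc)
  then show ?case
  proof cases
    case 1
    then show ?thesis by (auto intro!: poly_eqI simp: coeff_qdiff_poly coeff_eq_0)
  next
    case 2
    then show ?thesis
      using qHermite_Suc[OF q, of 0] q1
      by (simp add: qHermite_gamma_def qdiff_poly_pCons qnum_Suc)
         (simp add: one_pCons qdiff_poly_pCons)
  next
    case 3
    have g: "q * qnum q (Suc m) * qHermite_gamma q m = qHermite_gamma q (Suc m) * qnum q m"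
      using q by (cases m) (simp_all add: qHermite_gamma_def qnum_def field_simps)
    have IH1: "qdiff_poly q (qHermite q (Suc m)) = smult (qnum q (Suc m)) (qHermite q m)"
      using less[of "Suc m"] 3 by simp
    have IH2: "qdiff_poly q (qHermite q m) = smult (qnum q m) (qHermite q (m - 1))"
      using less[of m] 3 by simp
    have x: "pCons 0 (qHermite q m)
        = qHermite q (Suc m) + smult (qHermite_gamma q m) (qHermite q (m - 1))"
      by (simp add: qHermite_Suc[OF q])
    have "qdiff_poly q (qHermite q n)
        = smult (q * qnum q (Suc m)) (pCons 0 (qHermite q m)) + qHermite q (Suc m)
          - smult (qHermite_gamma q (Suc m) * qnum q m) (qHermite q (m - 1))"
      using q1 by (simp add: 3 qHermite_Suc[OF q, of "Suc m"] qdiff_poly_diff qdiff_poly_pCons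
          qdiff_poly_smult IH1 IH2)
    also have "\<dots> = smult (1 + q * qnum q (Suc m)) (qHermite q (Suc m))"
      unfolding x by (simp add: smult_add_right smult_add_left g)
    finally show ?thesis
      using q1 3 by (simp add: qnum_Suc)
  qed
qed

text \<open>
  For \<open>k > n\<close> the right-hand side is zero by the convention for negative indices, and the
  left-hand side because each application of \<open>D\<^sub>q\<close> lowers the degree.
\<close>

lemma qdiff_iter_qHermite:
  assumes q: "0 < q" "q < 1"
  shows "(qdiff_poly q ^^ k) (qHermite q n) = smult (qfalling q n k) (qHermite_int q (int n - int k))"
proof (cases "k \<le> n")
  case True
  have "(qdiff_poly q ^^ k) (qHermite q n) = smult (qfact q n / qfact q (n - k)) (qHermite q (n - k))"
    using True
  proof (induction k)
    case 0
    then show ?case using qfact_pos[OF q, of n] by simp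
  next
    case (Suc k)
    have f: "qfact q (n - k) = qnum q (n - k) * qfact q (n - Suc k)"
      using Suc.prems by (metis Suc_diff_Suc Suc_le_eq qfact_Suc)
    have "qnum q (n - k) > 0" using q Suc.prems by (simp add: qnum_pos)
    then show ?case
      using Suc by (simp add: qdiff_poly_smult qdiff_qHermite[OF q] f)
  qed
  moreover have "qfalling q n k = qfact q n / qfact q (n - k)"
  proof -
    have e: "q powi (int (k * n) - int (k choose 2)) = q ^ (k * n) / q ^ (k choose 2)"
      using q power_int_diff[of q "int (k * n)" "int (k choose 2)"]
      by (simp only: power_int_of_nat) simp
    have "qfalling q n k
        = (qpoch (q powi (- int n)) q k * q ^ (k * n)) / ((q - 1) ^ k * q ^ (k choose 2))"
      by (simp only: qfalling_def e) simp
    also have "\<dots> = qfact q n / qfact q (n - k)"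
      unfolding qpoch_neg_power[OF q True] using q by simp
    finally show ?thesis .
  qed
  moreover have "qHermite_int q (int n - int k) = qHermite q (n - k)"
    using True by (simp add: qHermite_int_def flip: of_nat_diff)
  ultimately show ?thesis by simp
next
  case False
  \<comment> \<open>The truncated bound \<open>Suc (degree p) - k\<close> is \<open>0\<close> once \<open>k > degree p\<close>, which leaves only zero.\<close>
  have "degree ((qdiff_poly q ^^ k) p) < Suc (degree p) - k \<or> (qdiff_poly q ^^ k) p = 0" for p k
  proof (induction k)
    case (Suc k)
    let ?r = "(qdiff_poly q ^^ k) p"
    show ?case
    proof (cases "qdiff_poly q ?r = 0")
      case False
      then have "coeff (qdiff_poly q ?r) (degree (qdiff_poly q ?r)) \<noteq> 0" by simp
      then have "coeff ?r (Suc (degree (qdiff_poly q ?r))) \<noteq> 0"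
        by (simp add: coeff_qdiff_poly)
      then have "Suc (degree (qdiff_poly q ?r)) \<le> degree ?r"
        by (rule le_degree)
      then show ?thesis using Suc False by auto
    qed simp
  qed simp
  from this[of k "qHermite q n"] False have "(qdiff_poly q ^^ k) (qHermite q n) = 0"
    by (simp add: degree_qHermite[OF q])
  then show ?thesis
    using False by (simp add: qHermite_int_def)
qed

section \<open>The Jackson integral against the weight\<close>

lemma convergent_qpoch:
  fixes a q :: real
  assumes "0 < q" "q < 1"
  shows "convergent_prod (\<lambda>i. 1 - a * q ^ i)"
proof (rule abs_convergent_prod_imp_convergent_prod, rule summable_imp_abs_convergent_prod)
  have "summable (\<lambda>i. \<bar>a\<bar> * q ^ i)"
    using assms by (intro summable_mult summable_geometric) simp
  then show "summable (\<lambda>i. norm (1 - a * q ^ i - 1))"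
    using assms by (simp add: abs_mult)
qed

lemma qpoch_tendsto:
  assumes "0 < q" "q < 1"
  shows "(\<lambda>n. qpoch a q n) \<longlonglongrightarrow> qpoch_inf a q"
  unfolding qpoch_def qpoch_inf_def
  using convergent_prod_LIMSEQ[OF convergent_qpoch[OF assms, of a]] LIMSEQ_lessThan_iff_atMost
  by blast

lemma qpoch_inf_pos:
  assumes "0 < q" "q < 1" "a < 1"
  shows "qpoch_inf a q > 0"
  unfolding qpoch_inf_def
proof (rule less_0_prodinf[OF convergent_qpoch[OF assms(1,2)]])
  fix i
  have "a * q ^ i < 1"
  proof (cases "a \<le> 0")
    case True
    then have "a * q ^ i \<le> 0" using assms by (simp add: mult_nonpos_nonneg)
    then show ?thesis by simp
  next
    case False
    then have "a * q ^ i \<le> a * 1"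
      using assms by (intro mult_left_mono power_le_one) auto
    then show ?thesis using assms by simp
  qed
  then show "0 < 1 - a * q ^ i" by simp
qed

lemma qpoch_Suc_shift: "qpoch a q (Suc n) = (1 - a) * qpoch (a * q) q n"
  unfolding qpoch_def by (subst prod.lessThan_Suc_shift) (simp add: mult_ac)

lemma qpoch_inf_unfold:
  assumes "0 < q" "q < 1"
  shows "qpoch_inf a q = (1 - a) * qpoch_inf (a * q) q"
proof (rule LIMSEQ_unique)
  show "(\<lambda>n. qpoch a q (Suc n)) \<longlonglongrightarrow> qpoch_inf a q"
    by (rule LIMSEQ_Suc[OF qpoch_tendsto[OF assms]])
  show "(\<lambda>n. qpoch a q (Suc n)) \<longlonglongrightarrow> (1 - a) * qpoch_inf (a * q) q"
    unfolding qpoch_Suc_shift by (intro tendsto_intros qpoch_tendsto assms)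
qed

text \<open>
  The weight pairs the parameters \<open>a\<close> and \<open>- a\<close>; their product is a single symbol in base \<open>q\<^sup>2\<close>.
\<close>

lemma qpoch_mult_neg: "qpoch a q n * qpoch (- a) q n = qpoch (a\<^sup>2) (q\<^sup>2) n"
  unfolding qpoch_def prod.distrib[symmetric]
  by (intro prod.cong refl) (simp add: power2_eq_square power_mult_distrib algebra_simps)

text \<open>
  The weight is even, so one value serves the two nodes \<open>q\<^sup>m\<close> and \<open>- q\<^sup>m\<close> of the Jackson
  integral.
\<close>

definition hermite_weight :: "real \<Rightarrow> nat \<Rightarrow> real" where
  "hermite_weight q m = qpoch_inf (q * q ^ m) q * qpoch_inf (- (q * q ^ m)) q"

lemma hermite_weight_pos:
  assumes "0 < q" "q < 1"
  shows "hermite_weight q m > 0"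
proof -
  have "q * q ^ m < 1"
    using assms power_Suc_less_one[of q m] by simp
  moreover have "- (q * q ^ m) < 1"
    using assms by (smt (verit) mult_pos_pos zero_less_power)
  ultimately show ?thesis
    unfolding hermite_weight_def by (intro mult_pos_pos qpoch_inf_pos assms)
qed

lemma hermite_weight_le_1:
  assumes "0 < q" "q < 1"
  shows "hermite_weight q m \<le> 1"
proof (rule LIMSEQ_le_const2)
  show "(\<lambda>n. qpoch (q * q ^ m) q n * qpoch (- (q * q ^ m)) q n) \<longlonglongrightarrow> hermite_weight q m"
    unfolding hermite_weight_def by (intro tendsto_mult qpoch_tendsto assms)
  have "qpoch ((q * q ^ m)\<^sup>2) (q\<^sup>2) n \<le> 1" for n
    unfolding qpoch_def
  proof (intro prod_le_1 conjI)
    fix i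
    have "(q * q ^ m)\<^sup>2 * (q\<^sup>2) ^ i \<le> 1 * 1"
      using assms by (intro mult_mono power_le_one mult_le_one) auto
    then show "0 \<le> 1 - (q * q ^ m)\<^sup>2 * (q\<^sup>2) ^ i" by simp
    show "1 - (q * q ^ m)\<^sup>2 * (q\<^sup>2) ^ i \<le> 1" using assms by simp
  qed
  then show "\<exists>N. \<forall>n\<ge>N. qpoch (q * q ^ m) q n * qpoch (- (q * q ^ m)) q n \<le> 1"
    by (simp add: qpoch_mult_neg)
qed

text \<open>
  The \<open>q\<close>-Pearson equation \<open>w(x/q) = (1 - x\<^sup>2) w(x)\<close> at the node \<open>x = q\<^sup>m\<^sup>+\<^sup>1\<close>.
\<close>

lemma hermite_weight_Suc:
  assumes "0 < q" "q < 1"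
  shows "hermite_weight q m = (1 - (q ^ Suc m)\<^sup>2) * hermite_weight q (Suc m)"
  unfolding hermite_weight_def
  by (subst (1 2) qpoch_inf_unfold[OF assms]) (simp add: power2_eq_square algebra_simps)

definition hermite_integral :: "real \<Rightarrow> real poly \<Rightarrow> real" where
  "hermite_integral q p = jackson_integral q
     (\<lambda>x. poly p x * (qpoch_inf (q * x) q * qpoch_inf (- (q * x)) q))"

lemma summable_hermite_integral:
  assumes "0 < q" "q < 1"
  shows "summable (\<lambda>m. q ^ m * hermite_weight q m * (poly p (q ^ m) + poly p (- (q ^ m))))"
proof -
  have "compact (poly p ` {-1..1})"
    by (intro compact_continuous_image continuous_intros) simp
  then obtain B where B: "\<And>x. x \<in> {-1..1} \<Longrightarrow> \<bar>poly p x\<bar> \<le> B"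
    by (metis bounded_real compact_imp_bounded image_eqI)
  show ?thesis
  proof (rule summable_comparison_test')
    show "summable (\<lambda>m. 2 * B * q ^ m)"
      using assms by (intro summable_mult summable_geometric) simp
    fix m
    have "q ^ m \<in> {-1..1}" "- (q ^ m) \<in> {-1..1}"
      using assms power_le_one[of q m] zero_less_power[of q m]
      unfolding atLeastAtMost_iff by linarith+
    then have "\<bar>poly p (q ^ m) + poly p (- (q ^ m))\<bar> \<le> 2 * B"
      using B[of "q ^ m"] B[of "- (q ^ m)"] by linarith
    then have "q ^ m * (hermite_weight q m * \<bar>poly p (q ^ m) + poly p (- (q ^ m))\<bar>)
        \<le> q ^ m * (1 * (2 * B))"
      using assms hermite_weight_le_1[OF assms, of m] hermite_weight_pos[OF assms, of m]
      by (intro mult_left_mono mult_mono) auto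
    then show "norm (q ^ m * hermite_weight q m * (poly p (q ^ m) + poly p (- (q ^ m))))
        \<le> 2 * B * q ^ m"
      using assms hermite_weight_pos[OF assms, of m] by (simp add: abs_mult mult_ac)
  qed
qed

lemma hermite_integral_eq:
  "hermite_integral q p
    = (1 - q) * (\<Sum>m. q ^ m * hermite_weight q m * (poly p (q ^ m) + poly p (- (q ^ m))))"
  unfolding hermite_integral_def jackson_integral_def hermite_weight_def
  by (simp add: algebra_simps)

lemma hermite_integral_add:
  assumes "0 < q" "q < 1"
  shows "hermite_integral q (p + r) = hermite_integral q p + hermite_integral q r"
proof -
  have "(\<lambda>m. q ^ m * hermite_weight q m * (poly (p + r) (q ^ m) + poly (p + r) (- (q ^ m))))
      = (\<lambda>m. q ^ m * hermite_weight q m * (poly p (q ^ m) + poly p (- (q ^ m)))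
           + q ^ m * hermite_weight q m * (poly r (q ^ m) + poly r (- (q ^ m))))"
    by (rule ext) (simp add: algebra_simps)
  then show ?thesis
    unfolding hermite_integral_eq
    by (simp only: suminf_add[OF summable_hermite_integral[OF assms]
          summable_hermite_integral[OF assms], symmetric] distrib_left[of "1 - q"])
qed

lemma hermite_integral_smult:
  assumes "0 < q" "q < 1"
  shows "hermite_integral q (smult c p) = c * hermite_integral q p"
proof -
  have "(\<lambda>m. q ^ m * hermite_weight q m * (poly (smult c p) (q ^ m) + poly (smult c p) (- (q ^ m))))
      = (\<lambda>m. c * (q ^ m * hermite_weight q m * (poly p (q ^ m) + poly p (- (q ^ m)))))"
    by (rule ext) (simp add: algebra_simps)
  then show ?thesis
    by (simp only: hermite_integral_eq suminf_mult[OF summable_hermite_integral[OF assms]]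
        mult.left_commute)
qed

lemma hermite_integral_diff:
  assumes "0 < q" "q < 1"
  shows "hermite_integral q (p - r) = hermite_integral q p - hermite_integral q r"
  using hermite_integral_add[OF assms, of p "smult (-1) r"] hermite_integral_smult[OF assms, of "-1" r]
  by simp

lemma hermite_integral_0 [simp]: "0 < q \<Longrightarrow> q < 1 \<Longrightarrow> hermite_integral q 0 = 0"
  using hermite_integral_smult[of q 0 0] by simp

lemma hermite_integral_sum:
  assumes "0 < q" "q < 1"
  shows "hermite_integral q (\<Sum>i\<in>S. f i) = (\<Sum>i\<in>S. hermite_integral q (f i))"
  by (induction S rule: infinite_finite_induct) (simp_all add: assms hermite_integral_add)

text \<open>
  By the \<open>q\<close>-Pearson equation, the \<open>m\<close>-th summand of the integral of \<open>(1 - q) D\<^sub>q p - x p\<close> is the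
  difference \<open>U m - U (Suc m)\<close> with \<open>U m = (1 - x\<^sup>2) w(x) (p(x) - p(-x))\<close> at \<open>x = q\<^sup>m\<close>.  There is no
  boundary contribution: \<open>1 - x\<^sup>2\<close> vanishes at \<open>x = 1\<close>, and \<open>p(x) - p(-x)\<close> tends to \<open>0\<close> with \<open>x\<close>.
\<close>

lemma hermite_integral_by_parts:
  assumes q: "0 < q" "q < 1"
  shows "hermite_integral q (pCons 0 p) = (1 - q) * hermite_integral q (qdiff_poly q p)"
proof -
  define r where "r = smult (1 - q) (qdiff_poly q p) - pCons 0 p"
  define D where "D t = poly p t - poly p (- t)" for t
  define U where "U m = (1 - (q ^ m)\<^sup>2) * hermite_weight q m * D (q ^ m)" for m
  have summand: "q ^ m * hermite_weight q m * (poly r (q ^ m) + poly r (- (q ^ m))) = U m - U (Suc m)"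
    for m
  proof -
    have dq: "t * ((1 - q) * poly (qdiff_poly q p) t) = poly p t - poly p (q * t)" for t
      using poly_qdiff_poly_mult[of q p t] q by (simp add: algebra_simps)
    have "q ^ m * (poly r (q ^ m) + poly r (- (q ^ m)))
        = (1 - (q ^ m)\<^sup>2) * D (q ^ m) - D (q ^ Suc m)"
      using dq[of "q ^ m"] dq[of "- (q ^ m)"]
      by (simp add: r_def D_def power2_eq_square algebra_simps)
    then have "q ^ m * hermite_weight q m * (poly r (q ^ m) + poly r (- (q ^ m)))
        = hermite_weight q m * ((1 - (q ^ m)\<^sup>2) * D (q ^ m) - D (q ^ Suc m))"
      by (metis mult.assoc mult.commute)
    also have "\<dots> = U m - hermite_weight q m * D (q ^ Suc m)"
      by (simp add: U_def algebra_simps)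
    also have "hermite_weight q m * D (q ^ Suc m) = U (Suc m)"
      by (subst hermite_weight_Suc[OF q]) (simp add: U_def)
    finally show ?thesis .
  qed
  have "U \<longlonglongrightarrow> 0"
  proof (rule Lim_null_comparison)
    show "eventually (\<lambda>m. norm (U m) \<le> \<bar>D (q ^ m)\<bar>) sequentially"
    proof (rule always_eventually, rule allI)
      fix m
      have "(q ^ m)\<^sup>2 \<le> 1" "(q ^ m)\<^sup>2 \<ge> 0"
        using q by (simp_all add: power_le_one)
      then have "\<bar>(1 - (q ^ m)\<^sup>2) * hermite_weight q m\<bar> \<le> 1"
        using hermite_weight_le_1[OF q, of m] hermite_weight_pos[OF q, of m]
        by (simp add: abs_mult mult_le_one)
      from mult_right_mono[OF this, of "\<bar>D (q ^ m)\<bar>"]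
      show "norm (U m) \<le> \<bar>D (q ^ m)\<bar>"
        by (simp add: U_def abs_mult)
    qed
    have "(\<lambda>m. \<bar>D (q ^ m)\<bar>) \<longlonglongrightarrow> \<bar>poly p 0 - poly p (- 0)\<bar>"
      unfolding D_def using q by (intro tendsto_intros) auto
    then show "(\<lambda>m. \<bar>D (q ^ m)\<bar>) \<longlonglongrightarrow> 0" by simp
  qed
  from telescope_sums'[OF this] have "hermite_integral q r = (1 - q) * U 0"
    unfolding hermite_integral_eq summand by (simp add: sums_iff)
  then have "hermite_integral q r = 0" by (simp add: U_def)
  then show ?thesis
    by (simp add: r_def hermite_integral_diff[OF q] hermite_integral_smult[OF q])
qed

text \<open>
  Iterating the Pearson equation expresses all weights through the one at \<open>x = 1\<close>.
\<close>

lemma hermite_weight_0_eq: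
  assumes "0 < q" "q < 1"
  shows "hermite_weight q m * qpoch (q\<^sup>2) (q\<^sup>2) m = hermite_weight q 0"
proof (induction m)
  case (Suc m)
  then show ?case
    using hermite_weight_Suc[OF assms, of m]
    by (simp add: qpoch_Suc power_mult_distrib power_mult[symmetric] mult_ac)
qed simp

text \<open>
  The finite form of Euler's identity \<open>(q; q\<^sup>2)\<^sub>\<infinity> (-q; q)\<^sub>\<infinity> = 1\<close>: the odd and even factors of
  \<open>(q; q)\<^sub>2\<^sub>n\<close> are \<open>(q; q\<^sup>2)\<^sub>n\<close> and \<open>(q\<^sup>2; q\<^sup>2)\<^sub>n\<close>.
\<close>

lemma qpoch_odd_mult_neg:
  assumes "0 < q" "q < 1"
  shows "qpoch q (q\<^sup>2) n * qpoch (- q) q n * qpoch q q n = qpoch q q (2 * n)"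
proof -
  have "qpoch q (q\<^sup>2) n * qpoch (q\<^sup>2) (q\<^sup>2) n = qpoch q q (2 * n)"
  proof (induction n)
    case (Suc n)
    have e: "q * (q\<^sup>2) ^ n = q * q ^ (2 * n)" "q\<^sup>2 * (q\<^sup>2) ^ n = q * q ^ Suc (2 * n)"
      by (simp_all only: power_mult power_Suc mult.assoc[symmetric] power2_eq_square)
    have "qpoch q (q\<^sup>2) (Suc n) * qpoch (q\<^sup>2) (q\<^sup>2) (Suc n)
        = (qpoch q (q\<^sup>2) n * qpoch (q\<^sup>2) (q\<^sup>2) n)
          * ((1 - q * (q\<^sup>2) ^ n) * (1 - q\<^sup>2 * (q\<^sup>2) ^ n))"
      by (simp add: qpoch_Suc)
    also have "\<dots> = qpoch q q (2 * Suc n)"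
      unfolding Suc.IH e by (simp add: qpoch_Suc)
    finally show ?case .
  qed simp
  moreover have "qpoch q q n * qpoch (- q) q n = qpoch (q\<^sup>2) (q\<^sup>2) n"
    by (rule qpoch_mult_neg)
  ultimately show ?thesis
    by (metis mult.assoc mult.commute)
qed

text \<open>
  With \<open>p = q\<^sup>2\<close>, the power series \<open>S(z)\<close> with coefficients \<open>1 / (p; p)\<^sub>m\<close> satisfies
  \<open>(1 - z) S(z) = S(p z)\<close>, hence \<open>(q; p)\<^sub>n S(q) = S(q p\<^sup>n) \<longlonglongrightarrow> S(0) = 1\<close>.  By Euler's identity
  the reciprocal of \<open>(q; q\<^sup>2)\<^sub>\<infinity>\<close> is \<open>(-q; q)\<^sub>\<infinity>\<close>.
\<close>

lemma euler_sum:
  assumes q: "0 < q" "q < 1"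
  shows "(\<Sum>m. q ^ m / qpoch (q\<^sup>2) (q\<^sup>2) m) = qpoch_inf (- q) q"
proof -
  define p where "p = q\<^sup>2"
  define A where "A m = 1 / qpoch p p m" for m
  define S where "S z = (\<Sum>m. A m * z ^ m)" for z
  have p: "0 < p" "p < 1"
    using q power_Suc_less_one[of q 1] by (simp_all add: p_def power2_eq_square)
  have A_Suc: "A m = (1 - p ^ Suc m) * A (Suc m)" for m
  proof -
    have "1 - p ^ Suc m > 0" using p power_Suc_less_one[of p m] by simp
    then show ?thesis by (simp add: A_def qpoch_Suc)
  qed
  have A_eq: "A m = hermite_weight q m / hermite_weight q 0" for m
  proof -
    have "qpoch p p m \<noteq> 0"
      using hermite_weight_0_eq[OF q, of m] hermite_weight_pos[OF q, of 0] by (auto simp: p_def)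
    then show ?thesis
      using hermite_weight_0_eq[OF q, of m] hermite_weight_pos[OF q, of 0]
      by (simp add: A_def p_def field_simps)
  qed
  have summable: "summable (\<lambda>m. A m * z ^ m)" if "\<bar>z\<bar> < 1" for z
  proof (rule summable_comparison_test')
    show "summable (\<lambda>m. 1 / hermite_weight q 0 * \<bar>z\<bar> ^ m)"
      using that by (intro summable_mult summable_geometric) simp
    fix m
    show "norm (A m * z ^ m) \<le> 1 / hermite_weight q 0 * \<bar>z\<bar> ^ m"
      using hermite_weight_pos[OF q, of 0] hermite_weight_pos[OF q, of m]
        hermite_weight_le_1[OF q, of m]
      by (simp add: A_eq abs_mult power_abs divide_simps mult_left_le_one_le)
  qed
  have step: "(1 - z) * S z = S (p * z)" if "\<bar>z\<bar> < 1" for z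
  proof -
    have z': "\<bar>p * z\<bar> < 1"
      using p that by (simp add: abs_mult) (smt (verit) mult_left_le_one_le abs_ge_zero)
    have "S z - S (p * z) = (\<Sum>m. A m * z ^ m - A m * (p * z) ^ m)"
      unfolding S_def by (intro suminf_diff summable that z')
    also have "\<dots> = (\<Sum>m. A (Suc m) * z ^ Suc m - A (Suc m) * (p * z) ^ Suc m)"
      by (subst suminf_split_head)
         (simp_all add: summable_diff[OF summable[OF that] summable[OF z']])
    also have "(\<lambda>m. A (Suc m) * z ^ Suc m - A (Suc m) * (p * z) ^ Suc m)
        = (\<lambda>m. z * (A m * z ^ m))"
      by (rule ext, subst (3) A_Suc) (simp add: power_mult_distrib algebra_simps)
    also have "suminf \<dots> = z * S z"
      unfolding S_def by (rule suminf_mult[OF summable[OF that]])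
    finally show ?thesis by (simp add: algebra_simps)
  qed
  have iter: "qpoch q p n * S q = S (q * p ^ n)" for n
  proof (induction n)
    case (Suc n)
    have "\<bar>q * p ^ n\<bar> < 1"
    proof -
      have "q * p ^ n \<le> q * 1"
        using q p by (intro mult_left_mono power_le_one) auto
      moreover have "q * p ^ n \<ge> 0" using q p by simp
      ultimately show ?thesis using q by linarith
    qed
    note z = step[OF this]
    have "qpoch q p (Suc n) * S q = (1 - q * p ^ n) * (qpoch q p n * S q)"
      by (simp add: qpoch_Suc)
    also have "\<dots> = S (q * p ^ Suc n)"
      unfolding Suc.IH z by (simp add: mult.left_commute)
    finally show ?case .
  qed simp
  have "isCont S 0"
  proof -
    have "isCont (\<lambda>z. \<Sum>m. A m * z ^ m) 0"
      by (rule isCont_powser[OF summable[of "1/2"]]) simp_all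
    then show ?thesis by (simp add: S_def[abs_def])
  qed
  moreover have "(\<lambda>n. q * p ^ n) \<longlonglongrightarrow> 0"
    using p by (intro tendsto_mult_right_zero LIMSEQ_realpow_zero) auto
  ultimately have "(\<lambda>n. S (q * p ^ n)) \<longlonglongrightarrow> S 0"
    by (rule isCont_tendsto_compose)
  moreover have "S 0 = 1"
    using powser_zero[of A] by (simp add: S_def A_def)
  ultimately have lim: "(\<lambda>n. qpoch q p n * S q) \<longlonglongrightarrow> 1"
    by (simp add: iter)
  \<comment> \<open>Multiplying by \<open>(-q; q)\<^sub>n (q; q)\<^sub>n\<close> completes the left-hand side to \<open>S(q) (q; q)\<^sub>2\<^sub>n\<close>.\<close>
  have "(\<lambda>n. qpoch q p n * S q * (qpoch (- q) q n * qpoch q q n))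
      \<longlonglongrightarrow> 1 * (qpoch_inf (- q) q * qpoch_inf q q)"
    by (intro tendsto_mult lim qpoch_tendsto q)
  moreover have "(\<lambda>n. qpoch q p n * S q * (qpoch (- q) q n * qpoch q q n))
      = (\<lambda>n. S q * qpoch q q (2 * n))"
    unfolding p_def qpoch_odd_mult_neg[OF q, symmetric] by (simp only: mult_ac)
  moreover have "(\<lambda>n. S q * qpoch q q (2 * n)) \<longlonglongrightarrow> S q * qpoch_inf q q"
    by (intro tendsto_mult tendsto_const filterlim_compose[OF qpoch_tendsto[OF q]])
       (rule filterlim_subseq, simp add: strict_mono_def)
  ultimately have "S q * qpoch_inf q q = qpoch_inf (- q) q * qpoch_inf q q"
    using LIMSEQ_unique by fastforce
  then have "S q = qpoch_inf (- q) q"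
    using qpoch_inf_pos[OF q q(2)] by simp
  then show ?thesis
    by (simp add: S_def A_def p_def)
qed

lemma hermite_integral_1:
  assumes q: "0 < q" "q < 1"
  shows "hermite_integral q 1 = qHermite_norm2 q 0"
proof -
  have w: "q ^ m * hermite_weight q m * (poly 1 (q ^ m) + poly 1 (- (q ^ m)))
      = 2 * hermite_weight q 0 * (q ^ m / qpoch (q\<^sup>2) (q\<^sup>2) m)" for m
  proof -
    have "qpoch (q\<^sup>2) (q\<^sup>2) m \<noteq> 0"
      using hermite_weight_0_eq[OF q, of m] hermite_weight_pos[OF q, of 0] by auto
    then show ?thesis
      using hermite_weight_0_eq[OF q, of m] by (simp add: field_simps)
  qed
  have s: "summable (\<lambda>m. q ^ m / qpoch (q\<^sup>2) (q\<^sup>2) m)"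
    using summable_hermite_integral[OF q, of 1] hermite_weight_pos[OF q, of 0]
    unfolding w by (subst (asm) summable_cmult_iff) simp
  have "hermite_integral q 1 = (1 - q) * (2 * hermite_weight q 0 * qpoch_inf (- q) q)"
    unfolding hermite_integral_eq w suminf_mult[OF s] euler_sum[OF q] ..
  then show ?thesis
    using qpoch_inf_unfold[OF q, of "-1"]
    by (simp add: qHermite_norm2_def hermite_weight_def numeral_2_eq_2[symmetric])
qed

section \<open>Orthogonality\<close>

lemma qHermite_norm2_Suc:
  "qHermite_norm2 q (Suc n) = qHermite_gamma q (Suc n) * qHermite_norm2 q n"
  by (simp add: qHermite_norm2_def qHermite_gamma_def qpoch_Suc choose_two_Suc power_add mult_ac)

lemma qHermite_gamma_pos: "0 < q \<Longrightarrow> q < 1 \<Longrightarrow> 0 < n \<Longrightarrow> qHermite_gamma q n > 0"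
  by (simp add: qHermite_gamma_def power_less_one_iff)

lemma qHermite_norm2_pos:
  assumes q: "0 < q" "q < 1"
  shows "qHermite_norm2 q n > 0"
proof (induction n)
  case 0
  show ?case
    using q by (simp add: qHermite_norm2_def qpoch_inf_pos)
qed (simp add: qHermite_norm2_Suc qHermite_gamma_pos q)

text \<open>
  Integrating the recurrence by parts gives
  \<open>L(H\<^sub>m\<^sub>+\<^sub>1) = (1 - q\<^sup>m) (1 - q\<^sup>m\<^sup>-\<^sup>1) L(H\<^sub>m\<^sub>-\<^sub>1)\<close> for \<open>m \<ge> 1\<close>; the factor vanishes at \<open>m = 1\<close>, where
  the induction would otherwise reach the non-zero integral of \<open>H\<^sub>0\<close>.
\<close>

lemma hermite_integral_qHermite:
  assumes q: "0 < q" "q < 1" and "n > 0"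
  shows "hermite_integral q (qHermite q n) = 0"
  using \<open>n > 0\<close>
proof (induction n rule: less_induct)
  case (less n)
  then obtain m where n: "n = Suc m" by (cases n) auto
  have "hermite_integral q (qHermite q n)
      = ((1 - q) * qnum q m - qHermite_gamma q m) * hermite_integral q (qHermite q (m - 1))"
    by (simp add: n qHermite_Suc[OF q] hermite_integral_diff[OF q] hermite_integral_smult[OF q]
        hermite_integral_by_parts[OF q] qdiff_qHermite[OF q] left_diff_distrib)
  also have "\<dots> = 0"
  proof (cases "m \<le> 1")
    case True
    then have "(1 - q) * qnum q m - qHermite_gamma q m = 0"
      using q by (cases m) (auto simp: qHermite_gamma_def qnum_def)
    then show ?thesis by simp
  next
    case False
    then show ?thesis using less.IH[of "m - 1"] n by simp
  qed
  finally show ?case .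
qed

text \<open>
  The recurrence moves each factor \<open>x\<close> of \<open>p\<close> over to \<open>H\<^sub>n\<close>, where it changes the index by at
  most one; the index stays positive because \<open>degree p < n\<close>.
\<close>

lemma hermite_integral_low_degree:
  assumes q: "0 < q" "q < 1" and "degree p < n"
  shows "hermite_integral q (p * qHermite q n) = 0"
  using \<open>degree p < n\<close>
proof (induction p arbitrary: n)
  case (pCons a p)
  have *: "hermite_integral q (pCons a p * qHermite q n)
      = a * hermite_integral q (qHermite q n) + hermite_integral q (p * qHermite q (Suc n))
        + qHermite_gamma q n * hermite_integral q (p * qHermite q (n - 1))"
  proof -
    have x: "pCons 0 (qHermite q n)
        = qHermite q (Suc n) + smult (qHermite_gamma q n) (qHermite q (n - 1))"
      by (simp add: qHermite_Suc[OF q])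
    have "pCons a p * qHermite q n = smult a (qHermite q n) + p * pCons 0 (qHermite q n)"
      by simp
    also have "\<dots> = smult a (qHermite q n) + p * qHermite q (Suc n)
        + smult (qHermite_gamma q n) (p * qHermite q (n - 1))"
      by (simp only: x distrib_left mult_smult_right add.assoc)
    finally show ?thesis
      by (simp only: hermite_integral_add[OF q] hermite_integral_smult[OF q])
  qed
  show ?case
  proof (cases "p = 0")
    case True
    then show ?thesis
      using * hermite_integral_qHermite[OF q] pCons.prems q by simp
  next
    case False
    then have "degree p < Suc n" "degree p < n - 1" "n > 0"
      using pCons.prems by auto
    then show ?thesis
      using * pCons.IH hermite_integral_qHermite[OF q] by simp
  qed
qed (use q in simp)

text \<open>
  Evaluate the integral of \<open>x H\<^sub>n H\<^sub>n\<^sub>+\<^sub>1\<close> by expanding \<open>x H\<^sub>n\<close> and by expanding \<open>x H\<^sub>n\<^sub>+\<^sub>1\<close>.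
\<close>

lemma hermite_integral_norm:
  assumes q: "0 < q" "q < 1"
  shows "hermite_integral q (qHermite q n * qHermite q n) = qHermite_norm2 q n"
proof (induction n)
  case 0
  show ?case using hermite_integral_1[OF q] by simp
next
  case (Suc n)
  let ?H = "qHermite q"
  have orth: "hermite_integral q (?H k * ?H m) = 0" if "k < m" for k m
    using that hermite_integral_low_degree[OF q, of "?H k" m] by (simp add: degree_qHermite q)
  have x: "pCons 0 (?H n) = ?H (Suc n) + smult (qHermite_gamma q n) (?H (n - 1))" for n
    by (simp add: qHermite_Suc[OF q])
  have "hermite_integral q (?H (Suc n) * ?H (Suc n)) = hermite_integral q (pCons 0 (?H n) * ?H (Suc n))"
    using orth[of "n - 1" "Suc n"]
    by (simp only: x distrib_right mult_smult_left hermite_integral_add[OF q]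
        hermite_integral_smult[OF q])
  also have "pCons 0 (?H n) * ?H (Suc n) = ?H n * pCons 0 (?H (Suc n))"
    by simp
  also have "hermite_integral q \<dots> = qHermite_gamma q (Suc n) * hermite_integral q (?H n * ?H n)"
    using orth[of n "Suc (Suc n)"]
    by (simp only: x[of "Suc n"] distrib_left mult_smult_right hermite_integral_add[OF q]
        hermite_integral_smult[OF q]) simp
  finally show ?case
    by (simp add: Suc qHermite_norm2_Suc)
qed

section \<open>The kernel in terms of two consecutive polynomials\<close>

lemma poly_qHermite_Suc:
  assumes "0 < q" "q < 1"
  shows "poly (qHermite q (Suc n)) x
    = x * poly (qHermite q n) x - qHermite_gamma q n * poly (qHermite q (n - 1)) x"
  by (simp add: qHermite_Suc[OF assms])

text \<open>
  An identity of polynomials in the second variable \<open>y\<close>, with \<open>x\<close> a parameter and \<open>[:x, -1:]\<close> the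
  factor \<open>x - y\<close>; in this form \<open>D\<^sub>q\<close> in \<open>y\<close> can be applied to it.  The norms satisfy
  \<open>qHermite_norm2_Suc\<close>, which cancels the \<open>\<gamma>\<close>-terms in the induction.
\<close>

lemma christoffel_darboux:
  assumes q: "0 < q" "q < 1"
  shows "[:x, -1:] * (\<Sum>k\<le>n. smult (poly (qHermite q k) x / qHermite_norm2 q k) (qHermite q k))
    = smult (1 / qHermite_norm2 q n)
        (smult (poly (qHermite q (Suc n)) x) (qHermite q n)
         - smult (poly (qHermite q n) x) (qHermite q (Suc n)))"
proof (induction n)
  case 0
  have "qHermite q (Suc 0) = [:0, 1:]"
    by (simp add: qHermite_Suc[OF q] qHermite_gamma_def one_pCons)
  then show ?case by (simp add: one_pCons)
next
  case (Suc n)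
  let ?H = "\<lambda>k. poly (qHermite q k)" and ?N = "qHermite_norm2 q n" and ?g = "qHermite_gamma q (Suc n)"
  have "poly ([:x, -1:] * (\<Sum>k\<le>Suc n. smult (?H k x / qHermite_norm2 q k) (qHermite q k))) y
      = poly (smult (1 / qHermite_norm2 q (Suc n))
          (smult (?H (Suc (Suc n)) x) (qHermite q (Suc n))
           - smult (?H (Suc n) x) (qHermite q (Suc (Suc n))))) y" for y
  proof -
    have pos: "?N > 0" "?g > 0"
      using qHermite_norm2_pos[OF q] qHermite_gamma_pos[OF q] by simp_all
    have "poly ([:x, -1:] * (\<Sum>k\<le>Suc n. smult (?H k x / qHermite_norm2 q k) (qHermite q k))) y
        = 1 / ?N * (?H (Suc n) x * ?H n y - ?H n x * ?H (Suc n) y)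
          + (x - y) * (?H (Suc n) x / (?g * ?N) * ?H (Suc n) y)"
      by (simp only: sum.atMost_Suc distrib_left Suc.IH poly_add poly_smult poly_diff poly_mult)
         (simp add: qHermite_norm2_Suc algebra_simps)
    also have "\<dots> = 1 / (?g * ?N) *
        ((x * ?H (Suc n) x - ?g * ?H n x) * ?H (Suc n) y
         - ?H (Suc n) x * (y * ?H (Suc n) y - ?g * ?H n y))"
      using pos by (simp add: field_simps)
    also have "\<dots> = poly (smult (1 / qHermite_norm2 q (Suc n))
          (smult (?H (Suc (Suc n)) x) (qHermite q (Suc n))
           - smult (?H (Suc n) x) (qHermite q (Suc (Suc n))))) y"
      using poly_qHermite_Suc[OF q, of "Suc n"] by (simp add: qHermite_norm2_Suc)
    finally show ?thesis .
  qed
  then show ?case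
    by (intro iffD1[OF poly_eq_poly_eq_iff] ext)
qed

text \<open>
  The \<open>q\<close>-Leibniz rule for the factor \<open>x - y\<close>, where \<open>D\<^sub>q\<close> acts on \<open>y\<close>.  Each application of
  \<open>D\<^sub>q\<close> shifts the factor to \<open>x - q\<^sup>k y\<close>.
\<close>

lemma qdiff_iter_linear_factor:
  assumes "q \<noteq> 1"
  shows "(qdiff_poly q ^^ k) ([:x, -1:] * p)
    = [:x, - (q ^ k):] * (qdiff_poly q ^^ k) p - smult (qnum q k) ((qdiff_poly q ^^ (k - 1)) p)"
proof (induction k)
  case (Suc k)
  have lin: "[:x, - c:] * r = smult x r - smult c (pCons 0 r)" for c and r :: "real poly"
    by simp
  have nk: "q ^ k + qnum q k = qnum q (Suc k)"
    using qnum_add[OF assms, of k 1] assms by (simp add: qnum_def)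
  let ?D = "\<lambda>k. (qdiff_poly q ^^ k) p"
  have "smult (qnum q k) (qdiff_poly q (?D (k - 1))) = smult (qnum q k) (?D k)"
    by (cases k) simp_all
  moreover have "(qdiff_poly q ^^ Suc k) ([:x, -1:] * p)
      = qdiff_poly q ([:x, - (q ^ k):] * ?D k - smult (qnum q k) (?D (k - 1)))"
    by (simp only: funpow.simps o_apply Suc.IH)
  ultimately have "(qdiff_poly q ^^ Suc k) ([:x, -1:] * p)
      = smult x (?D (Suc k)) - smult (q ^ k) (smult q (pCons 0 (?D (Suc k))) + ?D k)
        - smult (qnum q k) (?D k)"
    using assms by (simp only: funpow.simps o_apply lin qdiff_poly_diff qdiff_poly_smult
        qdiff_poly_pCons not_False_eq_True)
  also have "\<dots> = smult x (?D (Suc k)) - smult (q ^ Suc k) (pCons 0 (?D (Suc k)))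
        - smult (q ^ k + qnum q k) (?D k)"
    by (simp add: smult_add_right smult_add_left mult.commute)
  also have "\<dots> = [:x, - (q ^ Suc k):] * ?D (Suc k) - smult (qnum q (Suc k)) (?D (Suc k - 1))"
    by (simp only: nk lin diff_Suc_1)
  finally show ?case .
qed simp

text \<open>
  A formula for the derivatives of \<open>p = f / (x - y)\<close> in terms of those of \<open>f\<close>.  The Leibniz rule
  reads \<open>(x - q\<^sup>k y) D\<^sup>k p = D\<^sup>k f + [k]\<^sub>q D\<^sup>k\<^sup>-\<^sup>1 p\<close>; multiplying by the \<open>k\<close>-th \<open>q\<close>-power of \<open>x - y\<close>
  turns this into a first-order recursion, which the \<open>q\<close>-Taylor sum solves.
\<close>

lemma qdiff_iter_divided:
  assumes q: "0 < q" "q < 1"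
  shows "poly ((qdiff_poly q ^^ j) p) y * qsub_pow q x y (Suc j)
    = qfact q j * (\<Sum>k=0..j. poly ((qdiff_poly q ^^ k) ([:x, -1:] * p)) y / qfact q k * qsub_pow q x y k)"
proof (induction j)
  case 0
  show ?case
    using q by (simp add: qsub_pow_Suc algebra_simps)
next
  case (Suc j)
  let ?D = "\<lambda>k. poly ((qdiff_poly q ^^ k) p) y"
  let ?F = "\<lambda>k. poly ((qdiff_poly q ^^ k) ([:x, -1:] * p)) y"
  have F: "?F (Suc j) = (x - q ^ Suc j * y) * ?D (Suc j) - qnum q (Suc j) * ?D j"
    unfolding qdiff_iter_linear_factor[OF less_imp_neq[OF q(2)]]
    by (simp only: diff_Suc_1 poly_diff poly_mult poly_smult poly_pCons poly_0)
       (simp add: algebra_simps)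
  have "?D (Suc j) * qsub_pow q x y (Suc (Suc j))
      = ((x - q ^ Suc j * y) * ?D (Suc j)) * qsub_pow q x y (Suc j)"
    by (simp only: qsub_pow_Suc[OF q, of _ _ "Suc j"] mult_ac)
  also have "(x - q ^ Suc j * y) * ?D (Suc j) = ?F (Suc j) + qnum q (Suc j) * ?D j"
    by (simp only: F)
  also have "(?F (Suc j) + qnum q (Suc j) * ?D j) * qsub_pow q x y (Suc j)
      = ?F (Suc j) * qsub_pow q x y (Suc j) + qnum q (Suc j) * (?D j * qsub_pow q x y (Suc j))"
    by (simp only: distrib_right mult.assoc)
  also have "\<dots> = qfact q (Suc j) *
      (\<Sum>k=0..Suc j. ?F k / qfact q k * qsub_pow q x y k)"
    unfolding Suc.IH using qfact_pos[OF q, of j] qnum_pos[OF q, of "Suc j"]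
    by (simp add: qfact_Suc distrib_left)
  finally show ?case .
qed

lemma qkernel_eq_poly:
  assumes "q \<noteq> 1"
  shows "qkernel q n 0 j x y = poly ((qdiff_poly q ^^ j)
    (\<Sum>k\<le>n. smult (poly (qHermite q k) x / qHermite_norm2 q k) (qHermite q k))) y"
  unfolding qkernel_def qderiv_iter_poly[OF assms] qdiff_iter_sum qdiff_iter_smult poly_sum
    atLeast0AtMost by simp

lemma qkernel_eq_SA_SB:
  assumes q: "0 < q" "q < 1" and "n \<ge> 1" and nz: "qsub_pow q x y (j + 1) \<noteq> 0"
  shows "qkernel q (n - 1) 0 j x y
    = SA q j n x y * poly (qHermite q n) x + SB q j n x y * poly (qHermite q (n - 1)) x"
proof -
  have q1: "q \<noteq> 1" using q by simp
  have nz': "qsub_pow q x y (Suc j) \<noteq> 0" using nz by simp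
  obtain m where n: "n = Suc m" using \<open>n \<ge> 1\<close> by (cases n) auto
  let ?p = "\<Sum>k\<le>m. smult (poly (qHermite q k) x / qHermite_norm2 q k) (qHermite q k)"
  let ?D = "\<lambda>i k. poly ((qdiff_poly q ^^ k) (qHermite q i)) y"
  have "qkernel q m 0 j x y * qsub_pow q x y (Suc j)
      = qfact q j * (\<Sum>k=0..j. poly ((qdiff_poly q ^^ k) ([:x, -1:] * ?p)) y / qfact q k * qsub_pow q x y k)"
    unfolding qkernel_eq_poly[OF q1] by (rule qdiff_iter_divided[OF q])
  also have "(\<Sum>k=0..j. poly ((qdiff_poly q ^^ k) ([:x, -1:] * ?p)) y / qfact q k * qsub_pow q x y k)
     = 1 / qHermite_norm2 q m * (poly (qHermite q n) x * (\<Sum>k=0..j. ?D m k / qfact q k * qsub_pow q x y k)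
         - poly (qHermite q m) x * (\<Sum>k=0..j. ?D n k / qfact q k * qsub_pow q x y k))"
    unfolding christoffel_darboux[OF q]
    unfolding qdiff_iter_smult qdiff_iter_diff sum_distrib_left
      sum_subtractf[symmetric] n
    by (intro sum.cong refl) (simp add: diff_divide_distrib algebra_simps)
  finally have "qkernel q m 0 j x y
      = qfact q j * (1 / qHermite_norm2 q m * (poly (qHermite q n) x * (\<Sum>k=0..j. ?D m k / qfact q k * qsub_pow q x y k)
         - poly (qHermite q m) x * (\<Sum>k=0..j. ?D n k / qfact q k * qsub_pow q x y k)))
        / qsub_pow q x y (Suc j)"
    unfolding nonzero_eq_divide_eq[OF nz'] .
  then show ?thesis
    unfolding SA_def SB_def qderiv_iter_poly[OF q1]
    by (simp add: n diff_divide_distrib algebra_simps)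
qed

section \<open>The connection formula\<close>

text \<open>
  Used for the \<open>H\<^sub>k\<close> and for the Sobolev polynomials \<open>P\<^sub>k\<close>; the coefficient condition states that
  the degree is below \<open>n\<close> and includes \<open>p = 0\<close>.
\<close>

lemma monic_family_span:
  fixes B :: "nat \<Rightarrow> real poly"
  assumes B: "\<And>k. degree (B k) = k \<and> lead_coeff (B k) = 1"
    and p: "\<And>i. i \<ge> n \<Longrightarrow> coeff p i = 0"
  shows "\<exists>a. p = (\<Sum>k<n. smult (a k) (B k))"
  using p
proof (induction n arbitrary: p)
  case 0
  then have "p = 0" by (intro poly_eqI) simp
  then show ?case by simp
next
  case (Suc n)
  have Bn: "degree (B n) = n" "coeff (B n) n = 1"
    using B[of n] by auto
  let ?r = "p - smult (coeff p n) (B n)"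
  have "coeff ?r i = 0" if "i \<ge> n" for i
  proof (cases "i = n")
    case True
    then show ?thesis using Bn by simp
  next
    case False
    then show ?thesis using that Suc.prems[of i] Bn by (simp add: coeff_eq_0)
  qed
  from Suc.IH[OF this] obtain a where a: "?r = (\<Sum>k<n. smult (a k) (B k))" by blast
  have "p = (\<Sum>k<Suc n. smult ((a(n := coeff p n)) k) (B k))"
    using a by (simp add: algebra_simps)
  then show ?case by blast
qed

lemma sobolev_inner_eq:
  assumes "q \<noteq> 1"
  shows "sobolev_inner q \<alpha> lam j f g = hermite_integral q (f * g)
    + lam * poly ((qdiff_poly q ^^ j) f) \<alpha> * poly ((qdiff_poly q ^^ j) g) \<alpha>"
  by (simp add: sobolev_inner_def hermite_integral_def qderiv_iter_poly[OF assms])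

lemma sobolev_orthogonal_qHermite:
  assumes q: "0 < q" "q < 1" and P: "qHermite_Sobolev q \<alpha> lam j P" and "k < n"
  shows "sobolev_inner q \<alpha> lam j (P n) (qHermite q k) = 0"
proof -
  have q1: "q \<noteq> 1" using q by simp
  have "\<exists>a. qHermite q k = (\<Sum>i<n. smult (a i) (P i))"
  proof (rule monic_family_span)
    show "degree (P i) = i \<and> lead_coeff (P i) = 1" for i
      using P unfolding qHermite_Sobolev_def by blast
    show "coeff (qHermite q k) i = 0" if "i \<ge> n" for i
      using that \<open>k < n\<close> by (intro coeff_eq_0) (simp add: degree_qHermite q)
  qed
  then obtain a where a: "qHermite q k = (\<Sum>i<n. smult (a i) (P i))" by blast
  have "sobolev_inner q \<alpha> lam j (P n) (qHermite q k)
      = (\<Sum>i<n. a i * sobolev_inner q \<alpha> lam j (P n) (P i))"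
    by (simp add: a sobolev_inner_eq[OF q1] sum_distrib_left hermite_integral_sum[OF q]
        hermite_integral_smult[OF q] qdiff_iter_sum qdiff_iter_smult poly_sum sum.distrib
        distrib_left mult_ac)
  also have "\<dots> = 0"
    using P by (intro sum.neutral) (auto simp: qHermite_Sobolev_def)
  finally show ?thesis .
qed

text \<open>
  Orthogonality to \<open>H\<^sub>k\<close> forces the coefficient of \<open>H\<^sub>k\<close> in \<open>P\<^sub>n - H\<^sub>n\<close> to be
  \<open>- \<lambda> d (D\<^sub>q\<^sup>j H\<^sub>k)(\<alpha>) / \<parallel>H\<^sub>k\<parallel>\<^sup>2\<close> with the unknown \<open>d = (D\<^sub>q\<^sup>j P\<^sub>n)(\<alpha>)\<close>.  Taking \<open>D\<^sub>q\<^sup>j\<close> at \<open>\<alpha>\<close> gives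
  \<open>d (1 + \<lambda> K) = (D\<^sub>q\<^sup>j H\<^sub>n)(\<alpha>)\<close>, where \<open>K\<close> is a sum of squares over norms, so that the factor is
  positive; hence \<open>\<lambda> d = c\<^sub>n\<close>.
\<close>

lemma connection_formula:
  assumes q: "0 < q" "q < 1" and lam: "lam > 0" and P: "qHermite_Sobolev q \<alpha> lam j P" and n: "n \<ge> 1"
  shows "poly (P n) x = poly (qHermite q n) x - Sc q \<alpha> lam j n * qkernel q (n - 1) 0 j x \<alpha>"
proof -
  have q1: "q \<noteq> 1" using q by simp
  let ?H = "qHermite q" and ?N = "qHermite_norm2 q"
  define h where "h k = poly ((qdiff_poly q ^^ j) (?H k)) \<alpha>" for k
  define d where "d = poly ((qdiff_poly q ^^ j) (P n)) \<alpha>"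
  have "degree (P n) = n \<and> lead_coeff (P n) = 1"
    using P unfolding qHermite_Sobolev_def by blast
  then have Pn: "degree (P n) = n" "coeff (P n) n = 1" by auto
  have "coeff (P n - ?H n) i = 0" if "i \<ge> n" for i
    using that Pn degree_qHermite[OF q, of n] coeff_qHermite_self[OF q, of n]
    by (cases "i = n") (simp_all add: coeff_eq_0)
  then have "\<exists>a. P n - ?H n = (\<Sum>k<n. smult (a k) (?H k))"
    by (rule monic_family_span[OF degree_lead_coeff_qHermite[OF q]])
  then obtain a where "P n - ?H n = (\<Sum>k<n. smult (a k) (?H k))" by blast
  then have a: "P n = ?H n + (\<Sum>k<n. smult (a k) (?H k))" by (simp add: algebra_simps)
  have orth: "hermite_integral q (?H i * ?H k) = (if i = k then ?N k else 0)" for i k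
  proof -
    consider "i = k" | "i < k" | "k < i" by linarith
    then show ?thesis
    proof cases
      case 3
      then show ?thesis
        using hermite_integral_low_degree[OF q, of "?H k" i]
        by (simp add: degree_qHermite q mult.commute)
    qed (simp_all add: hermite_integral_norm hermite_integral_low_degree degree_qHermite q)
  qed
  have ak: "a k = - (lam * d) * h k / ?N k" if k: "k < n" for k
  proof -
    have "hermite_integral q (P n * ?H k) = a k * ?N k"
      using k by (simp add: a distrib_right sum_distrib_right hermite_integral_add[OF q]
          hermite_integral_sum[OF q] hermite_integral_smult[OF q] orth
          if_distrib[of "\<lambda>z. a _ * z"] cong: if_cong)
    then have "a k * ?N k + lam * d * h k = 0"
      using sobolev_orthogonal_qHermite[OF q P k] by (simp add: sobolev_inner_eq[OF q1] d_def h_def)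
    then show ?thesis
      using qHermite_norm2_pos[OF q, of k] by (simp add: field_simps)
  qed
  have K: "qkernel q (n - 1) j j \<alpha> \<alpha> = (\<Sum>k<n. h k * h k / ?N k)"
    using n by (simp add: qkernel_def qderiv_iter_poly[OF q1] h_def atLeast0AtMost
        lessThan_Suc_atMost[symmetric])
  have K0: "qkernel q (n - 1) 0 j x \<alpha> = (\<Sum>k<n. poly (?H k) x * h k / ?N k)"
    using n by (simp add: qkernel_def qderiv_iter_poly[OF q1] h_def atLeast0AtMost
        lessThan_Suc_atMost[symmetric])
  have "qkernel q (n - 1) j j \<alpha> \<alpha> \<ge> 0"
    unfolding K using less_imp_le[OF qHermite_norm2_pos[OF q]] by (intro sum_nonneg) simp
  then have pos: "1 + lam * qkernel q (n - 1) j j \<alpha> \<alpha> > 0"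
    using lam by (simp add: add_pos_nonneg)
  have "d = h n + (\<Sum>k<n. a k * h k)"
    by (simp add: d_def h_def a qdiff_iter_add qdiff_iter_sum qdiff_iter_smult poly_sum)
  also have "(\<Sum>k<n. a k * h k) = - (lam * d) * qkernel q (n - 1) j j \<alpha> \<alpha>"
    unfolding K sum_distrib_left by (intro sum.cong refl) (simp add: ak)
  finally have "d * (1 + lam * qkernel q (n - 1) j j \<alpha> \<alpha>) = h n"
    by (simp add: algebra_simps)
  then have "d = h n / (1 + lam * qkernel q (n - 1) j j \<alpha> \<alpha>)"
    using pos by (subst nonzero_eq_divide_eq) simp_all
  then have "lam * d = Sc q \<alpha> lam j n"
    by (simp add: Sc_def h_def qdiff_iter_qHermite[OF q])
  moreover have "poly (P n) x = poly (?H n) x - lam * d * qkernel q (n - 1) 0 j x \<alpha>"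
  proof -
    have "(\<Sum>k<n. a k * poly (?H k) x) = - (lam * d) * qkernel q (n - 1) 0 j x \<alpha>"
      unfolding K0 sum_distrib_left by (intro sum.cong refl) (simp add: ak)
    then show ?thesis by (simp add: a poly_sum)
  qed
  ultimately show ?thesis by simp
qed

section \<open>The structure relation\<close>

lemma qsub_pow_field_differentiable:
  assumes "0 < q" "q < 1"
  shows "(\<lambda>t. qsub_pow q t y k) field_differentiable (at x)"
proof (induction k)
  case (Suc k)
  then show ?case
    unfolding qsub_pow_Suc[OF assms]
    by (intro field_differentiable_mult field_differentiable_diff field_differentiable_ident
        field_differentiable_const)
qed (simp add: qsub_pow_0)

text \<open>
  Differentiability matters only at \<open>x = 0\<close>, where \<open>D\<^sub>q\<close> is the ordinary derivative and its
  product rule is not a formal identity.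
\<close>

lemma SA_SB_field_differentiable:
  assumes "0 < q" "q < 1" "qsub_pow q x y (j + 1) \<noteq> 0" "n \<ge> 1"
  shows "(\<lambda>t. SA q j n t y) field_differentiable (at x)"
    and "(\<lambda>t. SB q j n t y) field_differentiable (at x)"
  unfolding SA_def SB_def
  using assms less_imp_neq[OF qfact_pos[OF assms(1,2)], THEN not_sym] qHermite_norm2_pos[of q "n - 1"]
  by (auto intro!: field_differentiable_mult field_differentiable_divide field_differentiable_minus
      field_differentiable_sum qsub_pow_field_differentiable)

lemma qderiv_cong:
  assumes "x = 0 \<Longrightarrow> eventually (\<lambda>t. f t = g t) (nhds 0)" "f x = g x" "f (q * x) = g (q * x)"
  shows "qderiv q f x = qderiv q g x"
  using assms deriv_cong_ev[of f g 0 0] by (auto simp: qderiv_def)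

lemma qderiv_combination:
  assumes q: "0 < q" "q < 1"
    and diff: "x = 0 \<Longrightarrow> f field_differentiable at 0" "x = 0 \<Longrightarrow> g field_differentiable at 0"
  shows "qderiv q (\<lambda>t. poly u t - c * (f t * poly u t + g t * poly v t)) x
    = poly (qdiff_poly q u) x
      - c * (f (q * x) * poly (qdiff_poly q u) x + qderiv q f x * poly u x
           + g (q * x) * poly (qdiff_poly q v) x + qderiv q g x * poly v x)"
proof (cases "x = 0")
  case True
  have D: "(f has_field_derivative deriv f 0) (at 0)" "(g has_field_derivative deriv g 0) (at 0)"
    using diff True by (simp_all add: DERIV_deriv_iff_field_differentiable)
  have P: "deriv (poly p) 0 = poly (pderiv p) 0" for p :: "real poly"
    by (rule DERIV_imp_deriv) (rule poly_DERIV)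
  have "((\<lambda>t. poly u t - c * (f t * poly u t + g t * poly v t)) has_field_derivative
      poly (pderiv u) 0 - c * (f 0 * poly (pderiv u) 0 + deriv f 0 * poly u 0
         + g 0 * poly (pderiv v) 0 + deriv g 0 * poly v 0)) (at 0)"
    by (auto intro!: derivative_eq_intros D poly_DERIV)
  from DERIV_imp_deriv[OF this] show ?thesis
    using True q by (simp add: qderiv_def P qderiv_poly[symmetric])
next
  case False
  have "poly p (q * x) = poly p x + (q - 1) * x * poly (qdiff_poly q p) x" for p
    using poly_qdiff_poly_mult[of q p x] q by (simp add: algebra_simps)
  then show ?thesis
    using False q by (simp add: qderiv_def divide_simps) (simp add: algebra_simps)
qed

theorem proposition7:
  fixes q \<alpha> lam :: real and j n :: nat and P :: "nat \<Rightarrow> real poly" and x :: real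
  assumes "0 < q" and "q < 1"
    and "\<bar>\<alpha>\<bar> > 1"
    and "lam > 0"
    and "qHermite_Sobolev q \<alpha> lam j P"
    and "n \<ge> 2"
    and "qsub_pow q x \<alpha> (j + 1) \<noteq> 0" and "qsub_pow q (q * x) \<alpha> (j + 1) \<noteq> 0"
  shows "SXi1 q \<alpha> lam j n x * qderiv q (poly (P n)) x =
           SE4 q \<alpha> lam j n x * poly (P n) x + SF4 q \<alpha> lam j n x * poly (P (n - 1)) x"
proof -
  note q = assms(1,2)
  let ?u = "poly (qHermite q n)" and ?v = "poly (qHermite q (n - 1))"
  let ?w = "poly (qHermite q (n - 2))" and ?g = "qHermite_gamma q (n - 1)"
  have g: "?g > 0" using qHermite_gamma_pos[OF q] assms by simp
  have w: "?w x = (x * ?v x - ?u x) / ?g"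
  proof -
    have "?u x = x * ?v x - ?g * ?w x"
      using poly_qHermite_Suc[OF q, of "n - 1" x] assms
      by (simp add: Suc_diff_Suc numeral_2_eq_2)
    then show ?thesis using g by (simp add: field_simps)
  qed
  have conn: "poly (P m) t = poly (qHermite q m) t - Sc q \<alpha> lam j m *
      (SA q j m t \<alpha> * poly (qHermite q m) t + SB q j m t \<alpha> * poly (qHermite q (m - 1)) t)"
    if "m \<ge> 1" "qsub_pow q t \<alpha> (j + 1) \<noteq> 0" for m t
    using that connection_formula[OF q assms(4,5)] qkernel_eq_SA_SB[OF q] by simp
  have P1: "poly (P n) x = SE1 q \<alpha> lam j n x * ?u x + SF1 q \<alpha> lam j n x * ?v x"
    using conn[of n x] assms by (simp add: SE1_def SF1_def algebra_simps)
  \<comment> \<open>The index \<open>n - 1\<close> brings in \<open>H\<^sub>n\<^sub>-\<^sub>2\<close>, which the recurrence \<open>w\<close> eliminates.\<close>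
  have P2: "poly (P (n - 1)) x = SE2 q \<alpha> lam j n x * ?u x + SF2 q \<alpha> lam j n x * ?v x"
  proof -
    have "poly (P (n - 1)) x = SE1 q \<alpha> lam j (n - 1) x * ?v x + SF1 q \<alpha> lam j (n - 1) x * ?w x"
      using conn[of "n - 1" x] assms
      by (simp add: SE1_def SF1_def algebra_simps numeral_2_eq_2)
    also have "\<dots> = SE2 q \<alpha> lam j n x * ?u x + SF2 q \<alpha> lam j n x * ?v x"
      unfolding w SE2_def SF2_def using g by (simp add: field_simps)
    finally show ?thesis .
  qed
  have P3: "qderiv q (poly (P n)) x = SE3 q \<alpha> lam j n x * ?u x + SF3 q \<alpha> lam j n x * ?v x"
  proof -
    let ?R = "\<lambda>t. ?u t - Sc q \<alpha> lam j n * (SA q j n t \<alpha> * ?u t + SB q j n t \<alpha> * ?v t)"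
    have "qderiv q (poly (P n)) x = qderiv q ?R x"
    proof (rule qderiv_cong)
      \<comment> \<open>At \<open>x = 0\<close> the derivative needs the connection formula on a whole neighbourhood, which
        continuity of the denominator provides.\<close>
      assume "x = 0"
      have "isCont (\<lambda>t. qsub_pow q t \<alpha> (j + 1)) 0"
        by (rule field_differentiable_imp_continuous_at[OF qsub_pow_field_differentiable[OF q]])
      then have "eventually (\<lambda>t. qsub_pow q t \<alpha> (j + 1) \<noteq> 0) (nhds 0)"
        using assms(7) \<open>x = 0\<close> unfolding isCont_def
        by (intro tendsto_imp_eventually_ne[OF iffD1[OF tendsto_at_iff_tendsto_nhds]]) simp_all
      then show "eventually (\<lambda>t. poly (P n) t = ?R t) (nhds 0)"
        by (rule eventually_mono) (use conn assms in simp)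
    qed (use conn assms in simp_all)
    also have "\<dots> = poly (qdiff_poly q (qHermite q n)) x
      - Sc q \<alpha> lam j n * (SA q j n (q * x) \<alpha> * poly (qdiff_poly q (qHermite q n)) x
           + qderiv q (\<lambda>t. SA q j n t \<alpha>) x * ?u x
           + SB q j n (q * x) \<alpha> * poly (qdiff_poly q (qHermite q (n - 1))) x
           + qderiv q (\<lambda>t. SB q j n t \<alpha>) x * ?v x)"
      using assms SA_SB_field_differentiable[OF q, of x \<alpha> j n]
      by (intro qderiv_combination) auto
    also have "\<dots> = SE3 q \<alpha> lam j n x * ?u x + SF3 q \<alpha> lam j n x * ?v x"
    proof -
      have idx: "n - 1 - 1 = n - 2" by simp
      show ?thesis
        unfolding qdiff_qHermite[OF q] poly_smult SE3_def SF3_def SC1_def SD1_def idx w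
        using g by (simp add: field_simps)
    qed
    finally show ?thesis .
  qed
  show ?thesis
    unfolding P1 P2 P3 SXi1_def SE4_def SF4_def det_2 by (simp add: vector_2 algebra_simps)
qed

end
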